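(* Let $x_0\in\mathbb{R}^d$ be a fixed vector with distinct entries. Suppose we are given the data $y_0=x_0^\downarrow$ and $z_0=Ax_0$, where the matrix $A\in\mathbb{R}^{m\times d}$ has independent standard normal entries. Consider the convex program $$\text{minimize }\|x\|_{\mathcal{P}(y_0)}\quad\text{subject to}\quad z_0=Ax,$$ with decision variable $x\in\mathbb{R}^d$, and say that it succeeds when it has a unique minimizer and this minimizer equals $x_0$. In the range $0\le\lambda<\sqrt{\mathrm{H}_d}$, it holds that $$m\le d-\mathrm{H}_d-\lambda\sqrt{\mathrm{H}_d}\ \Longrightarrow\ \text{the program succeeds with probability}\le 4e^{-\lambda^2/16};$$ $$m\ge d-\mathrm{H}_d+\lambda\sqrt{\mathrm{H}_d}\ \Longrightarrow\ \text{the program succeeds with probability}\ge 1-4e^{-\lambda^2/16}.$$ Here $\mathrm{H}_d:=\sum_{i=1}^d i^{-1}$ is the $d$th harmonic number, which satisfies $\log d<\mathrm{H}_d<1+\log d$.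
   Context: $x_0^\downarrow$ is the vector whose entries are the components of $x_0$ listed in weakly decreasing order. The permutahedron generated by $y\in\mathbb{R}^d$ is $\mathcal{P}(y):=\mathrm{conv}\{\sigma(y):\sigma\text{ a coordinate permutation}\}$. The Minkowski gauge is $\|x\|_{\mathcal{P}(y)}:=\inf\{\tau>0:x\in\tau\,\mathcal{P}(y)\}$.
   Formalization: The strict upper bound H_d < 1 + log d is stated only for d ≥ 2, because for d = 1 both sides equal 1; everything else is stated for every d ≥ 1. *)

theory Defs
  imports "HOL-Probability.Probability" "HOL-Combinatorics.Combinatorics"
begin

definition permute_coords :: "('d \<Rightarrow> 'd) \<Rightarrow> real ^ 'd \<Rightarrow> real ^ 'd" where
  "permute_coords \<sigma> y = (\<chi> i. y $ \<sigma> i)"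

definition permutahedron :: "real ^ 'd \<Rightarrow> (real ^ 'd) set" where
  "permutahedron y = convex hull {permute_coords \<sigma> y | \<sigma>. \<sigma> permutes UNIV}"

text \<open>
  The gauge is extended-real valued: the infimum of the empty set is \<open>\<infinity>\<close>. This matters for
  permutahedra, which have empty interior, so the gauge is not finite everywhere.
\<close>

definition minkowski_gauge :: "'a::real_vector set \<Rightarrow> 'a \<Rightarrow> ereal" where
  "minkowski_gauge K x = Inf (ereal ` {\<tau>. \<tau> > 0 \<and> x \<in> (\<lambda>v. \<tau> *\<^sub>R v) ` K})"

text \<open>
  The index type carries a linear order, so that listing the coordinates is meaningful;
  \<open>card {j. j < i}\<close> is the (zero-based) position of the index \<open>i\<close>.
\<close>

definition sort_decreasing :: "(real, 'd::{finite,linorder}) vec \<Rightarrow> (real, 'd) vec" where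
  "sort_decreasing x =
     (\<chi> i. rev (sort (map (\<lambda>j. x $ j) (sorted_list_of_set UNIV))) ! card {j. j < i})"

lemma card_less_index:
  fixes i :: "'d::{finite,linorder}"
  shows "card {j. j < i} < CARD('d)"
  by (rule psubset_card_mono) auto

lemma sort_decreasing_antimono:
  fixes x :: "(real, 'd::{finite,linorder}) vec"
  assumes "i \<le> j"
  shows "sort_decreasing x $ j \<le> sort_decreasing x $ i"
proof -
  have "card {k. k < i} \<le> card {k. k < j}"
    using assms by (intro card_mono) auto
  then show ?thesis
    unfolding sort_decreasing_def
    using card_less_index[of j] by (auto intro!: sorted_rev_nth_mono)
qed

lemma sort_decreasing_permutation:
  fixes x :: "(real, 'd::{finite,linorder}) vec"
  shows "\<exists>\<sigma>. \<sigma> permutes UNIV \<and> sort_decreasing x = permute_coords \<sigma> x"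
proof -
  let ?xs = "map (\<lambda>j. x $ j) (sorted_list_of_set (UNIV :: 'd set))"
  let ?ys = "rev (sort ?xs)"
  let ?us = "sorted_list_of_set (UNIV :: 'd set)"
  let ?r = "\<lambda>i::'d. card {j. j < i}"
  have len: "length ?us = CARD('d)" by simp
  have "mset ?ys = mset ?xs" by simp
  then obtain p where p: "p permutes {..<length ?xs}" "permute_list p ?xs = ?ys"
    by (rule mset_eq_permutation)
  have r: "inj ?r"
  proof (rule linorder_injI)
    fix a b :: 'd assume "a < b"
    then have "card {j. j < a} < card {j. j < b}"
      by (intro psubset_card_mono) (auto dest: less_trans)
    then show "card {j. j < a} \<noteq> card {j. j < b}" by simp
  qed
  define \<sigma> where "\<sigma> = (\<lambda>i. ?us ! p (?r i))"
  have plt: "p k < CARD('d)" if "k < CARD('d)" for k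
    using permutes_in_image[OF p(1), of k] that by simp
  have "inj \<sigma>"
  proof (rule injI)
    fix a b assume "\<sigma> a = \<sigma> b"
    then have "p (?r a) = p (?r b)"
      using plt[OF card_less_index[of a]] plt[OF card_less_index[of b]]
      by (simp add: \<sigma>_def nth_eq_iff_index_eq)
    then have "?r a = ?r b" using permutes_inj[OF p(1)] by (auto dest: injD)
    then show "a = b" using r by (auto dest: injD)
  qed
  then have "bij \<sigma>" by (simp add: bij_def finite_UNIV_inj_surj)
  then have "\<sigma> permutes UNIV" by (simp add: permutes_def bij_iff)
  moreover have "sort_decreasing x = permute_coords \<sigma> x"
  proof (subst vec_eq_iff, rule allI)
    fix i
    have "?ys ! ?r i = permute_list p ?xs ! ?r i" using p(2) by simp
    also have "\<dots> = ?xs ! p (?r i)"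
      by (rule permute_list_nth[OF p(1)]) (use card_less_index[of i] in simp)
    also have "\<dots> = x $ \<sigma> i"
      using plt[OF card_less_index[of i]] by (simp add: \<sigma>_def)
    finally show "sort_decreasing x $ i = permute_coords \<sigma> x $ i"
      by (simp add: sort_decreasing_def permute_coords_def)
  qed
  ultimately show ?thesis by blast
qed

definition std_normal_matrix :: "'w measure \<Rightarrow> ('w \<Rightarrow> real ^ 'd ^ 'm) \<Rightarrow> bool" where
  "std_normal_matrix M A \<longleftrightarrow>
     prob_space.indep_vars M (\<lambda>_. borel) (\<lambda>(i, j) \<omega>. A \<omega> $ i $ j) UNIV \<and>
     (\<forall>i j. distributed M lborel (\<lambda>\<omega>. A \<omega> $ i $ j) std_normal_density)"

definition gauge_program_minimizers ::
    "real ^ 'd \<Rightarrow> real ^ 'm \<Rightarrow> real ^ 'd ^ 'm \<Rightarrow> (real ^ 'd) set" where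
  "gauge_program_minimizers y\<^sub>0 z\<^sub>0 A =
     {x. is_arg_min (minkowski_gauge (permutahedron y\<^sub>0)) (\<lambda>x. z\<^sub>0 = A *v x) x}"

definition program_succeeds :: "(real, 'd::{finite,linorder}) vec \<Rightarrow> (real, 'd) vec ^ 'm \<Rightarrow> bool" where
  "program_succeeds x\<^sub>0 A \<longleftrightarrow>
     gauge_program_minimizers (sort_decreasing x\<^sub>0) (A *v x\<^sub>0) A = {x\<^sub>0}"

end

theory Submission
  imports Defs
begin

text \<open>
  Let \<open>a\<^sub>1, \<dots>, a\<^sub>d\<close> be the columns of \<open>A\<close>. By convex duality the program succeeds iff some
  \<open>w\<close> in the row space, \<open>w\<^sub>j = \<langle>a\<^sub>j, c\<rangle>\<close>, satisfies \<open>\<langle>w, p\<rangle> < \<langle>w, x\<^sub>0\<rangle>\<close> for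
  every permutation \<open>p \<noteq> x\<^sub>0\<close> of \<open>x\<^sub>0\<close> and for \<open>p = 0\<close>. The permutations force \<open>w\<close> to
  order the indices exactly as \<open>x\<^sub>0\<close> does; the point \<open>0\<close> is then separated as
  soon as \<open>\<Sum>w\<^sub>j\<close> has the sign of the sum of \<open>x\<^sub>0\<close>. Every ordering realised on the hyperplane
  \<open>\<Sum>w\<^sub>j = 0\<close> of the row space is also realised with either sign, by a small perturbation, so this
  costs at most one dimension.

  Since the columns are exchangeable, the probability that a given ordering is realised is the
  expected number of realised orderings divided by \<open>d!\<close>. That number is governed by Cover's recursion
  \<open>Q (n + 1, l) = Q (n, l) + n * Q (n, l - 1)\<close> for linearly inducible orderings of points in
  dimension \<open>l\<close>: the recursion is an upper bound for every configuration, and it is exact for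
  points in general position, hence almost surely. After division by \<open>d!\<close> it describes a sum of
  independent Bernoulli variables with parameters \<open>1 / i\<close>, whose mean is a harmonic number, and
  Chernoff bounds, proved by induction along the recursion, give the two tails.
\<close>

section \<open>Orderings induced by linear functionals\<close>

text \<open>The subspace \<open>V\<close> of admissible functionals is a parameter because a tie
  between two points cuts it down to a hyperplane section.\<close>

definition orders :: "('i \<Rightarrow> 'a::euclidean_space) \<Rightarrow> 'i set \<Rightarrow> 'a set \<Rightarrow> 'i list set" where
  "orders a S V = {xs. set xs = S \<and> (\<exists>c\<in>V. sorted_wrt (\<lambda>i j. a i \<bullet> c < a j \<bullet> c) xs)}"

lemma sorted_wrt_inner_distinct:
  "sorted_wrt (\<lambda>i j. a i \<bullet> c < a j \<bullet> c) xs \<Longrightarrow> distinct xs"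
  by (induction xs) auto

lemma orders_subset_permutations: "orders a S V \<subseteq> permutations_of_set S"
  by (auto simp: orders_def permutations_of_set_def intro: sorted_wrt_inner_distinct)

lemma finite_orders: "finite S \<Longrightarrow> finite (orders a S V)"
  by (rule finite_subset[OF orders_subset_permutations]) simp

lemma orders_mono: "V \<subseteq> W \<Longrightarrow> orders a S V \<subseteq> orders a S W"
  by (auto simp: orders_def)

section \<open>Inserting one more point into a given ordering\<close>

definition insert_positions :: "('i \<Rightarrow> 'a::euclidean_space) \<Rightarrow> 'i \<Rightarrow> 'a set \<Rightarrow> 'i list \<Rightarrow> nat set" where
  "insert_positions a k V xs = {p. p \<le> length xs \<and>
     (\<exists>c\<in>V. sorted_wrt (\<lambda>i j. a i \<bullet> c < a j \<bullet> c) (take p xs @ k # drop p xs))}"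

lemma finite_insert_positions: "finite (insert_positions a k V xs)"
  by (rule finite_subset[of _ "{..length xs}"]) (auto simp: insert_positions_def)

lemma sorted_wrt_insert_at_iff:
  assumes "p \<le> length xs"
  shows "sorted_wrt (\<lambda>i j. a i \<bullet> c < a j \<bullet> c) (take p xs @ k # drop p xs) \<longleftrightarrow>
    sorted_wrt (\<lambda>i j. a i \<bullet> c < a j \<bullet> c) xs \<and>
    (\<forall>j<p. a (xs ! j) \<bullet> c < a k \<bullet> c) \<and>
    (\<forall>j<length xs. p \<le> j \<longrightarrow> a k \<bullet> c < a (xs ! j) \<bullet> c)"
proof -
  let ?P = "\<lambda>i j. a i \<bullet> c < a j \<bullet> c"
  have "sorted_wrt ?P xs \<longleftrightarrow> sorted_wrt ?P (take p xs @ drop p xs)" by simp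
  also have "\<dots> \<longleftrightarrow> sorted_wrt ?P (take p xs) \<and> sorted_wrt ?P (drop p xs) \<and>
      (\<forall>x\<in>set (take p xs). \<forall>y\<in>set (drop p xs). ?P x y)"
    by (simp only: sorted_wrt_append)
  finally have 1: "sorted_wrt ?P xs \<longleftrightarrow> \<dots>" .
  have 2: "(\<forall>j<p. ?P (xs ! j) k) \<longleftrightarrow> (\<forall>x\<in>set (take p xs). ?P x k)"
    using assms by (fastforce simp: in_set_conv_nth)
  have 3: "(\<forall>j<length xs. p \<le> j \<longrightarrow> ?P k (xs ! j)) \<longleftrightarrow> (\<forall>x\<in>set (drop p xs). ?P k x)"
  proof
    assume L: "\<forall>j<length xs. p \<le> j \<longrightarrow> ?P k (xs ! j)"
    show "\<forall>x\<in>set (drop p xs). ?P k x"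
    proof
      fix x assume "x \<in> set (drop p xs)"
      then obtain j where "j < length xs - p" "x = xs ! (p + j)"
        using assms by (auto simp: in_set_conv_nth)
      then show "?P k x" using L by simp
    qed
  next
    assume R: "\<forall>x\<in>set (drop p xs). ?P k x"
    show "\<forall>j<length xs. p \<le> j \<longrightarrow> ?P k (xs ! j)"
    proof (intro allI impI)
      fix j assume "j < length xs" "p \<le> j"
      then have "xs ! j \<in> set (drop p xs)"
        by (auto simp: in_set_conv_nth intro!: exI[of _ "j - p"])
      then show "?P k (xs ! j)" using R by blast
    qed
  qed
  show ?thesis unfolding 1 2 3 by (auto simp: sorted_wrt_append)
qed

definition tie_positions :: "('i \<Rightarrow> 'a::euclidean_space) \<Rightarrow> 'i \<Rightarrow> 'a set \<Rightarrow> 'i list \<Rightarrow> nat set" where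
  "tie_positions a k V xs = {j. j < length xs \<and>
     xs \<in> orders a (set xs) (V \<inter> {c. (a (xs ! j) - a k) \<bullet> c = 0})}"

lemma finite_tie_positions: "finite (tie_positions a k V xs)"
  by (rule finite_subset[of _ "{..length xs}"]) (auto simp: tie_positions_def)

text \<open>The functionals realising \<open>xs\<close> form a convex cone: if one puts
  \<open>k\<close> below \<open>xs ! j\<close> and another puts it above, a combination of them
  makes the two tie.\<close>

lemma tie_positionsI:
  assumes V: "subspace V" and p: "p \<in> insert_positions a k V xs" and q: "q \<in> insert_positions a k V xs"
    and j: "p \<le> j" "j < q"
  shows "j \<in> tie_positions a k V xs"
proof -
  let ?f = "\<lambda>c. (a (xs ! j) - a k) \<bullet> c"
  have len: "p \<le> length xs" "q \<le> length xs" using p q by (auto simp: insert_positions_def)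
  obtain c where c: "c \<in> V" "sorted_wrt (\<lambda>i j. a i \<bullet> c < a j \<bullet> c) xs" "?f c > 0"
    using p len j by (fastforce simp: insert_positions_def sorted_wrt_insert_at_iff inner_diff_left)
  obtain d where d: "d \<in> V" "sorted_wrt (\<lambda>i j. a i \<bullet> d < a j \<bullet> d) xs" "?f d < 0"
    using q len j by (fastforce simp: insert_positions_def sorted_wrt_insert_at_iff inner_diff_left)
  \<comment> \<open>Both weights are positive, so the order of \<open>xs\<close> is kept, and they
    are chosen so that \<open>?f\<close> cancels.\<close>
  define e where "e = (- ?f d) *\<^sub>R c + ?f c *\<^sub>R d"
  have "e \<in> V" unfolding e_def using V c d by (intro subspace_add subspace_scale)
  moreover have "?f e = 0" by (simp add: e_def inner_diff_right mult.commute)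
  moreover have "sorted_wrt (\<lambda>i j. a i \<bullet> e < a j \<bullet> e) xs"
    unfolding sorted_wrt_iff_nth_less
  proof (intro allI impI)
    fix r s assume rs: "r < s" "s < length xs"
    have "a (xs ! r) \<bullet> c < a (xs ! s) \<bullet> c" "a (xs ! r) \<bullet> d < a (xs ! s) \<bullet> d"
      using c(2) d(2) rs by (auto simp: sorted_wrt_iff_nth_less)
    then show "a (xs ! r) \<bullet> e < a (xs ! s) \<bullet> e"
      unfolding e_def inner_add_right inner_scaleR_right
      using c(3) d(3) by (intro add_strict_mono mult_strict_left_mono) auto
  qed
  ultimately show ?thesis using j len unfolding tie_positions_def orders_def by auto
qed

text \<open>All positions lie between the smallest and the largest one, and every unit step between
  these two passes a tie.\<close>

lemma card_insert_positions_le: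
  assumes V: "subspace V"
  shows "card (insert_positions a k V xs) \<le> Suc (card (tie_positions a k V xs))"
proof (cases "insert_positions a k V xs = {}")
  case False
  let ?P = "insert_positions a k V xs"
  have fin: "finite ?P" by (rule finite_insert_positions)
  have "?P \<subseteq> {Min ?P..Max ?P}" using fin by auto
  then have "card ?P \<le> card {Min ?P..Max ?P}" by (intro card_mono) auto
  also have "\<dots> \<le> Suc (card {Min ?P..<Max ?P})" by simp
  also have "{Min ?P..<Max ?P} \<subseteq> tie_positions a k V xs"
    using tie_positionsI[OF V Min_in[OF fin False] Max_in[OF fin False]] by auto
  then have "Suc (card {Min ?P..<Max ?P}) \<le> Suc (card (tie_positions a k V xs))"
    by (simp only: Suc_le_mono) (intro card_mono finite_tie_positions)
  finally show ?thesis .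
qed simp

text \<open>An ordering amounts to finitely many strict inequalities, each continuous in
  \<open>e\<close>, so it survives small moves in any direction \<open>u\<close>.\<close>

lemma eventually_sorted_wrt_perturb:
  fixes a :: "'i \<Rightarrow> 'a::euclidean_space"
  assumes "sorted_wrt (\<lambda>i j. a i \<bullet> c < a j \<bullet> c) xs"
  shows "eventually (\<lambda>e. sorted_wrt (\<lambda>i j. a i \<bullet> (c + e *\<^sub>R u) < a j \<bullet> (c + e *\<^sub>R u)) xs) (at_right 0)"
proof -
  let ?I = "{(r, s). r < s \<and> s < length xs}"
  let ?f = "\<lambda>x. a (xs ! fst x) - a (xs ! snd x)"
  have fin: "finite ?I" by (rule finite_subset[of _ "{..<length xs} \<times> {..<length xs}"]) auto
  have "eventually (\<lambda>e. \<forall>x\<in>?I. ?f x \<bullet> (c + e *\<^sub>R u) < 0) (at_right 0)"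
  proof (rule eventually_ball_finite[OF fin], rule ballI)
    fix x assume x: "x \<in> ?I"
    have "((\<lambda>e. ?f x \<bullet> (c + e *\<^sub>R u)) \<longlongrightarrow> ?f x \<bullet> (c + 0 *\<^sub>R u)) (at_right 0)"
      by (intro tendsto_intros)
    moreover have "?f x \<bullet> (c + 0 *\<^sub>R u) < 0"
      using x assms by (auto simp: sorted_wrt_iff_nth_less inner_diff_left)
    ultimately show "eventually (\<lambda>e. ?f x \<bullet> (c + e *\<^sub>R u) < 0) (at_right 0)"
      by (rule order_tendstoD)
  qed
  then show ?thesis
    by (rule eventually_mono) (simp add: sorted_wrt_iff_nth_less inner_diff_left)
qed

text \<open>A functional that ties \<open>k\<close> with \<open>xs ! j\<close> is moved slightly
  along \<open>u\<close>. The sign of \<open>u\<close> on the difference decides on which side of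
  \<open>xs ! j\<close> the element \<open>k\<close> lands; all other comparisons persist.\<close>

lemma insert_position_beside_tie:
  assumes V: "subspace V" and j: "j \<in> tie_positions a k V xs"
    and u: "u \<in> V"
      "q = j \<and> (a (xs ! j) - a k) \<bullet> u > 0 \<or> q = Suc j \<and> (a (xs ! j) - a k) \<bullet> u < 0"
  shows "q \<in> insert_positions a k V xs"
proof -
  let ?n = "length xs"
  have jl: "j < ?n" using j by (simp add: tie_positions_def)
  obtain c where c: "c \<in> V" "sorted_wrt (\<lambda>i j. a i \<bullet> c < a j \<bullet> c) xs"
      "(a (xs ! j) - a k) \<bullet> c = 0"
    using j by (auto simp: tie_positions_def orders_def)
  have eq: "a k \<bullet> c = a (xs ! j) \<bullet> c" using c(3) by (simp add: inner_diff_left)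
  \<comment> \<open>Being tied with \<open>xs ! j\<close>, the element \<open>k\<close> may take its
    place in the list. Perturbing this second list controls \<open>k\<close> against all entries
    other than \<open>xs ! j\<close>.\<close>
  have srt': "sorted_wrt (\<lambda>i j. a i \<bullet> c < a j \<bullet> c) (take j xs @ k # drop (Suc j) xs)"
  proof -
    have "sorted_wrt (\<lambda>i j. a i \<bullet> c < a j \<bullet> c) (take j xs @ xs ! j # drop (Suc j) xs)"
      using c(2) jl by (simp add: Cons_nth_drop_Suc)
    then show ?thesis by (simp add: sorted_wrt_append eq)
  qed
  have "eventually (\<lambda>e::real. 0 < e) (at_right 0)"
    by (simp add: eventually_at_right_less)
  then have "eventually (\<lambda>e. 0 < e \<and>
      sorted_wrt (\<lambda>i j. a i \<bullet> (c + e *\<^sub>R u) < a j \<bullet> (c + e *\<^sub>R u)) xs \<and>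
      sorted_wrt (\<lambda>i j. a i \<bullet> (c + e *\<^sub>R u) < a j \<bullet> (c + e *\<^sub>R u))
        (take j xs @ k # drop (Suc j) xs)) (at_right 0)"
    by (intro eventually_conj eventually_sorted_wrt_perturb c(2) srt')
  from eventually_happens'[OF trivial_limit_at_right_real this]
  obtain e where e: "0 < e"
      "sorted_wrt (\<lambda>i j. a i \<bullet> (c + e *\<^sub>R u) < a j \<bullet> (c + e *\<^sub>R u)) xs"
      "sorted_wrt (\<lambda>i j. a i \<bullet> (c + e *\<^sub>R u) < a j \<bullet> (c + e *\<^sub>R u))
        (take j xs @ k # drop (Suc j) xs)" by blast
  let ?c = "c + e *\<^sub>R u"
  have cV: "?c \<in> V" using V c u by (intro subspace_add subspace_scale)
  have lo: "a (xs ! r) \<bullet> ?c < a k \<bullet> ?c" if "r < j" for r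
  proof -
    have "xs ! r \<in> set (take j xs)" using that jl by (auto simp: in_set_conv_nth intro!: exI[of _ r])
    then show ?thesis using e(3) by (simp only: sorted_wrt_append) auto
  qed
  have hi: "a k \<bullet> ?c < a (xs ! r) \<bullet> ?c" if "j < r" "r < ?n" for r
  proof -
    have "xs ! r \<in> set (drop (Suc j) xs)"
      using that by (auto simp: in_set_conv_nth intro!: exI[of _ "r - Suc j"])
    then show ?thesis using e(3) by (simp only: sorted_wrt_append sorted_wrt.simps)
  qed
  have mid: "q = j \<and> a k \<bullet> ?c < a (xs ! j) \<bullet> ?c \<or> q = Suc j \<and> a (xs ! j) \<bullet> ?c < a k \<bullet> ?c"
    using u(2) e(1) eq by (auto simp: inner_diff_left inner_add_right)
  have ql: "q \<le> ?n" using u(2) jl by auto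
  have srt: "sorted_wrt (\<lambda>i j. a i \<bullet> ?c < a j \<bullet> ?c) (take q xs @ k # drop q xs)"
    unfolding sorted_wrt_insert_at_iff[OF ql]
  proof (intro conjI allI impI)
    show "sorted_wrt (\<lambda>i j. a i \<bullet> ?c < a j \<bullet> ?c) xs"
      by (rule e(2))
    show "a (xs ! r) \<bullet> ?c < a k \<bullet> ?c" if "r < q" for r
      using lo[of r] mid that by (cases "r = j") auto
    show "a k \<bullet> ?c < a (xs ! r) \<bullet> ?c" if "r < ?n" "q \<le> r" for r
      using hi[of r] mid that by (cases "r = j") auto
  qed
  show ?thesis unfolding insert_positions_def using ql cV srt by blast
qed

text \<open>A tie can be broken by a perturbation; without ties, any functional realising
  \<open>xs\<close> already gives \<open>k\<close> a strict place.\<close>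

lemma insert_positions_nonempty:
  assumes V: "subspace V" and xs: "xs \<in> orders a S V"
    and cross: "\<And>i. i \<in> S \<Longrightarrow> \<exists>u\<in>V. (a i - a k) \<bullet> u > 0"
  shows "insert_positions a k V xs \<noteq> {}"
proof (cases "tie_positions a k V xs = {}")
  case False
  then obtain j where j: "j \<in> tie_positions a k V xs" by blast
  then have "xs ! j \<in> S" using xs by (auto simp: tie_positions_def orders_def)
  then show ?thesis using insert_position_beside_tie[OF V j, of _ j] cross by blast
next
  case True
  obtain c where c: "c \<in> V" "sorted_wrt (\<lambda>i j. a i \<bullet> c < a j \<bullet> c) xs"
    using xs by (auto simp: orders_def)
  have ne: "a (xs ! j) \<bullet> c \<noteq> a k \<bullet> c" if "j < length xs" for j
    using True c that by (auto simp: tie_positions_def orders_def inner_diff_left)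
  \<comment> \<open>The first entry above \<open>k\<close>; the value \<open>length xs\<close>
    covers the case that \<open>k\<close> lies above all entries.\<close>
  define p where "p = (LEAST p. p = length xs \<or> a k \<bullet> c < a (xs ! p) \<bullet> c)"
  have p: "p = length xs \<or> a k \<bullet> c < a (xs ! p) \<bullet> c"
    unfolding p_def by (rule LeastI[of _ "length xs"]) simp
  have "p \<le> length xs" unfolding p_def by (rule Least_le) simp
  moreover have "a (xs ! j) \<bullet> c < a k \<bullet> c" if "j < p" for j
    using not_less_Least[OF that[unfolded p_def]] ne[of j] that \<open>p \<le> length xs\<close> by auto
  moreover have "a k \<bullet> c < a (xs ! j) \<bullet> c" if "j < length xs" "p \<le> j" for j
  proof (cases "p = j")
    case True
    then show ?thesis using p that by auto
  next
    case False
    then have "a (xs ! p) \<bullet> c < a (xs ! j) \<bullet> c"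
      using c(2) that by (auto simp: sorted_wrt_iff_nth_less)
    then show ?thesis using p that by auto
  qed
  ultimately have "p \<in> insert_positions a k V xs"
    using c by (auto simp: insert_positions_def sorted_wrt_insert_at_iff)
  then show ?thesis by blast
qed

text \<open>Every tie opens the positions on both of its sides, so all ties are positions and the
  successor of the largest tie is one more.\<close>

lemma card_insert_positions_ge:
  assumes V: "subspace V" and xs: "xs \<in> orders a S V"
    and cross: "\<And>i. i \<in> S \<Longrightarrow> \<exists>u\<in>V. (a i - a k) \<bullet> u \<noteq> 0"
  shows "Suc (card (tie_positions a k V xs)) \<le> card (insert_positions a k V xs)"
proof -
  let ?P = "insert_positions a k V xs" and ?J = "tie_positions a k V xs"
  have pos: "\<exists>u\<in>V. (a i - a k) \<bullet> u > 0" if i: "i \<in> S" for i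
  proof -
    obtain u where u: "u \<in> V" "(a i - a k) \<bullet> u \<noteq> 0" using cross[OF i] by blast
    then have "(a i - a k) \<bullet> u > 0 \<or> (a i - a k) \<bullet> (- u) > 0" by auto
    then show ?thesis using u(1) subspace_neg[OF V u(1)] by blast
  qed
  have inS: "xs ! j \<in> S" if "j \<in> ?J" for j
    using that xs by (auto simp: tie_positions_def orders_def)
  have J: "j \<in> ?P" "Suc j \<in> ?P" if j: "j \<in> ?J" for j
  proof -
    obtain u where u: "u \<in> V" "(a (xs ! j) - a k) \<bullet> u > 0" using pos[OF inS[OF j]] by blast
    then show "j \<in> ?P" by (intro insert_position_beside_tie[OF V j u(1)]) simp
    show "Suc j \<in> ?P"
      using u by (intro insert_position_beside_tie[OF V j subspace_neg[OF V u(1)]]) simp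
  qed
  have fin: "finite ?P" "finite ?J" by (rule finite_insert_positions finite_tie_positions)+
  show ?thesis
  proof (cases "?J = {}")
    case True
    then show ?thesis
      using insert_positions_nonempty[OF V xs pos] fin by (simp add: Suc_le_eq card_gt_0_iff)
  next
    case False
    have "Suc (Max ?J) \<in> ?P" using J(2) Max_in[OF fin(2) False] by blast
    then have "insert (Suc (Max ?J)) ?J \<subseteq> ?P" using J(1) by blast
    then have "card (insert (Suc (Max ?J)) ?J) \<le> card ?P" using fin by (intro card_mono)
    moreover have "Suc (Max ?J) \<notin> ?J" using Max_ge[OF fin(2), of "Suc (Max ?J)"] by auto
    ultimately show ?thesis using fin by simp
  qed
qed

section \<open>Cover's recursion and the number of orderings\<close>

text \<open>Double counting of pairs of an ordering and a tie: the index \<open>j\<close> is traded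
  for the element \<open>xs ! j\<close>, whose tie with \<open>k\<close> defines a
  hyperplane.\<close>

lemma sum_card_tie_positions:
  assumes S: "finite S"
  shows "(\<Sum>xs\<in>orders a S V. card (tie_positions a k V xs)) =
    (\<Sum>i\<in>S. card (orders a S (V \<inter> {c. (a i - a k) \<bullet> c = 0})))"
proof -
  let ?R = "\<lambda>i. orders a S (V \<inter> {c. (a i - a k) \<bullet> c = 0})"
  have "card (tie_positions a k V xs) = card {i\<in>S. xs \<in> ?R i}" if xs: "xs \<in> orders a S V" for xs
  proof (rule bij_betw_same_card[of "\<lambda>j. xs ! j"])
    have "distinct xs" "set xs = S"
      using xs by (auto simp: orders_def intro: sorted_wrt_inner_distinct)
    then show "bij_betw (\<lambda>j. xs ! j) (tie_positions a k V xs) {i \<in> S. xs \<in> ?R i}"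
      by (auto simp: bij_betw_def tie_positions_def inj_on_def nth_eq_iff_index_eq in_set_conv_nth)
  qed
  then have "(\<Sum>xs\<in>orders a S V. card (tie_positions a k V xs)) =
      (\<Sum>xs\<in>orders a S V. \<Sum>i\<in>S. if xs \<in> ?R i then 1 else 0)"
    using S by (intro sum.cong) (auto simp: sum.If_cases Int_def)
  also have "\<dots> = (\<Sum>i\<in>S. \<Sum>xs\<in>orders a S V. if xs \<in> ?R i then 1 else 0)"
    by (rule sum.swap)
  also have "\<dots> = (\<Sum>i\<in>S. card (?R i))"
  proof (rule sum.cong[OF refl])
    fix i
    have "{xs \<in> orders a S V. xs \<in> ?R i} = ?R i" using orders_mono[of _ V] by blast
    then show "(\<Sum>xs\<in>orders a S V. if xs \<in> ?R i then 1 else 0) = card (?R i)"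
      using finite_orders[OF S] by (subst sum.inter_filter[symmetric]) simp_all
  qed
  finally show ?thesis .
qed

text \<open>Deleting \<open>k\<close> and remembering where it stood is a bijection onto pairs of an
  ordering of \<open>S\<close> and an admissible position.\<close>

lemma card_orders_insert:
  assumes S: "finite S" "k \<notin> S"
  shows "card (orders a (insert k S) V) = (\<Sum>xs\<in>orders a S V. card (insert_positions a k V xs))"
proof -
  let ?ins = "\<lambda>(xs, p). take p xs @ k # drop p xs"
  let ?X = "SIGMA xs:orders a S V. insert_positions a k V xs"
  have "bij_betw ?ins ?X (orders a (insert k S) V)"
    unfolding bij_betw_def
  proof
    show "inj_on ?ins ?X"
    proof (rule inj_onI, clarify)
      fix xs p ys q
      assume *: "xs \<in> orders a S V" "ys \<in> orders a S V" "p \<in> insert_positions a k V xs"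
        "q \<in> insert_positions a k V ys"
        and eq: "take p xs @ k # drop p xs = take q ys @ k # drop q ys"
      have "k \<notin> set (take p xs)" "k \<notin> set (take q ys)" "k \<notin> set (drop p xs)"
        using * S set_take_subset[of p xs] set_take_subset[of q ys] set_drop_subset[of p xs]
        by (auto simp: orders_def)
      then have "take p xs = take q ys" "drop p xs = drop q ys"
        using eq by (auto simp: append_Cons_eq_iff)
      moreover have "p \<le> length xs" "q \<le> length ys" using * by (auto simp: insert_positions_def)
      ultimately show "xs = ys \<and> p = q"
        by (metis append_take_drop_id length_take min.absorb2)
    qed
    show "?ins ` ?X = orders a (insert k S) V"
    proof (intro equalityI subsetI)
      fix ys assume "ys \<in> ?ins ` ?X"
      then obtain xs p where "xs \<in> orders a S V" "p \<in> insert_positions a k V xs"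
        "ys = take p xs @ k # drop p xs" by auto
      then show "ys \<in> orders a (insert k S) V"
        using set_append[of "take p xs" "drop p xs"]
        by (auto simp: orders_def insert_positions_def)
    next
      fix ys assume ys: "ys \<in> orders a (insert k S) V"
      then obtain c where c: "c \<in> V" "sorted_wrt (\<lambda>i j. a i \<bullet> c < a j \<bullet> c) ys"
        by (auto simp: orders_def)
      have "k \<in> set ys" using ys by (auto simp: orders_def)
      then obtain us vs where uv: "ys = us @ k # vs" by (auto simp: in_set_conv_decomp)
      have "distinct ys" by (rule sorted_wrt_inner_distinct[OF c(2)])
      then have "set (us @ vs) = S" using ys S uv by (auto simp: orders_def)
      moreover have "sorted_wrt (\<lambda>i j. a i \<bullet> c < a j \<bullet> c) (us @ vs)"
        using c uv by (auto simp: sorted_wrt_append)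
      ultimately have "us @ vs \<in> orders a S V" using c by (auto simp: orders_def)
      moreover have "length us \<in> insert_positions a k V (us @ vs)"
        using c uv by (auto simp: insert_positions_def)
      moreover have "ys = ?ins (us @ vs, length us)" using uv by simp
      ultimately show "ys \<in> ?ins ` ?X" by (intro image_eqI[of _ _ "(us @ vs, length us)"]) auto
    qed
  qed
  then have "card (orders a (insert k S) V) = card ?X" by (rule bij_betw_same_card[symmetric])
  also have "\<dots> = (\<Sum>xs\<in>orders a S V. card (insert_positions a k V xs))"
    by (rule card_SigmaI) (auto simp: finite_orders S finite_insert_positions)
  finally show ?thesis .
qed

lemma card_orders_insert_le:
  assumes S: "finite S" "k \<notin> S" and V: "subspace V"
  shows "card (orders a (insert k S) V) \<le>
    card (orders a S V) + (\<Sum>i\<in>S. card (orders a S (V \<inter> {c. (a i - a k) \<bullet> c = 0})))"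
proof -
  have "card (orders a (insert k S) V) \<le> (\<Sum>xs\<in>orders a S V. Suc (card (tie_positions a k V xs)))"
    unfolding card_orders_insert[OF S] by (intro sum_mono card_insert_positions_le V)
  also have "\<dots> = card (orders a S V) + (\<Sum>xs\<in>orders a S V. card (tie_positions a k V xs))"
    by (simp add: sum_Suc)
  finally show ?thesis unfolding sum_card_tie_positions[OF S(1)] .
qed

text \<open>By \<open>cross\<close> no element of \<open>S\<close> is tied to \<open>k\<close> on
  all of \<open>V\<close>, so every tie can be broken; together with the upper bound the recursion
  is then exact.\<close>

lemma card_orders_insert_ge:
  assumes S: "finite S" "k \<notin> S" and V: "subspace V"
    and cross: "\<And>i. i \<in> S \<Longrightarrow> \<exists>u\<in>V. (a i - a k) \<bullet> u \<noteq> 0"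
  shows "card (orders a S V) + (\<Sum>i\<in>S. card (orders a S (V \<inter> {c. (a i - a k) \<bullet> c = 0})))
    \<le> card (orders a (insert k S) V)"
proof -
  have "card (orders a S V) + (\<Sum>xs\<in>orders a S V. card (tie_positions a k V xs)) =
      (\<Sum>xs\<in>orders a S V. Suc (card (tie_positions a k V xs)))"
    by (simp add: sum_Suc)
  also have "\<dots> \<le> card (orders a (insert k S) V)"
    unfolding card_orders_insert[OF S] by (intro sum_mono card_insert_positions_ge V cross)
  finally show ?thesis unfolding sum_card_tie_positions[OF S(1)] .
qed

text \<open>
  \<open>order_count n l\<close> is the number of orderings of \<open>n + 1\<close> points in general position in dimension
  \<open>l\<close>.
\<close>

fun order_count :: "nat \<Rightarrow> nat \<Rightarrow> nat" where
  "order_count 0 l = 1"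
| "order_count (Suc n) 0 = 0"
| "order_count (Suc n) (Suc l) = order_count n (Suc l) + Suc n * order_count n l"

lemma order_count_mono: "l \<le> l' \<Longrightarrow> order_count n l \<le> order_count n l'"
proof (induction n arbitrary: l l')
  case (Suc n)
  then show ?case by (cases l; cases l') (auto intro!: add_mono mult_le_mono2)
qed simp

lemma card_orders_singleton_le: "card (orders a {x} V) \<le> 1"
proof -
  have "permutations_of_set {x} = {[x]}" by (simp add: permutations_of_set_singleton)
  then show ?thesis using card_mono[OF _ orders_subset_permutations[of a "{x}" V]] by simp
qed

text \<open>Induction on \<open>S\<close> for all \<open>V\<close> at once, since the induction
  hypothesis is applied to hyperplane sections, whose dimension is smaller by at least one.\<close>

lemma card_orders_le:
  fixes a :: "'i \<Rightarrow> 'a::euclidean_space"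
  assumes "finite S" "S \<noteq> {}" "subspace V"
  shows "card (orders a S V) \<le> order_count (card S - 1) (dim V)"
  using assms
proof (induction S arbitrary: V rule: finite_ne_induct)
  case (singleton x)
  then show ?case using card_orders_singleton_le[of a x V] by simp
next
  case (insert k S)
  obtain n where n: "card S = Suc n" using insert by (metis card_0_eq not0_implies_Suc)
  let ?V = "\<lambda>i. V \<inter> {c. (a i - a k) \<bullet> c = 0}"
  show ?case
  proof (cases "\<exists>i\<in>S. \<forall>c\<in>V. (a i - a k) \<bullet> c = 0")
    \<comment> \<open>If \<open>i\<close> and \<open>k\<close> agree on all of \<open>V\<close>, no
      strict ordering contains both and the count is zero.\<close>
    case True
    then obtain i where i: "i \<in> S" "\<And>c. c \<in> V \<Longrightarrow> a i \<bullet> c = a k \<bullet> c" by (auto simp: inner_diff_left)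
    have "orders a (insert k S) V = {}"
    proof (rule ccontr)
      assume "orders a (insert k S) V \<noteq> {}"
      then obtain xs c where xs: "set xs = insert k S" "c \<in> V"
        "sorted_wrt (\<lambda>i j. a i \<bullet> c < a j \<bullet> c) xs" by (auto simp: orders_def)
      then obtain p q where pq: "p < length xs" "q < length xs" "xs ! p = k" "xs ! q = i"
        using i(1) by (metis in_set_conv_nth insertCI)
      have "p \<noteq> q" using pq i(1) insert by auto
      then show False using xs pq i(2)[OF xs(2)]
        by (metis linorder_neqE_nat order_less_irrefl sorted_wrt_nth_less)
    qed
    then show ?thesis by simp
  next
    case False
    have sub: "subspace (?V i)" for i
      using insert.prems by (intro subspace_inter subspace_hyperplane)
    have dim: "Suc (dim (?V i)) \<le> dim V" if "i \<in> S" for i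
    proof -
      have "?V i \<subset> V" using False that by auto
      then have "dim (?V i) < dim V"
        using dim_psubset[of "?V i" V] sub insert.prems by (simp add: span_eq_iff[THEN iffD2])
      then show ?thesis by simp
    qed
    obtain l where l: "dim V = Suc l"
      using dim insert.hyps(2) by (metis Suc_le_D all_not_in_conv)
    have "card (orders a (insert k S) V) \<le> card (orders a S V) + (\<Sum>i\<in>S. card (orders a S (?V i)))"
      by (rule card_orders_insert_le) (use insert in auto)
    also have "\<dots> \<le> order_count n (Suc l) + (\<Sum>i\<in>S. order_count n l)"
    proof (intro add_mono sum_mono)
      show "card (orders a S V) \<le> order_count n (Suc l)" using insert.IH[OF insert.prems] n l by simp
      fix i assume "i \<in> S"
      have "card (orders a S (?V i)) \<le> order_count n (dim (?V i))" using insert.IH[OF sub] n by simp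
      also have "\<dots> \<le> order_count n l" using dim[OF \<open>i \<in> S\<close>] l by (intro order_count_mono) simp
      finally show "card (orders a S (?V i)) \<le> order_count n l" .
    qed
    finally show ?thesis using insert n l by simp
  qed
qed

text \<open>
  \<open>B\<close> collects the constraints imposed so far. The last assumption says that they do not identify
  two elements of \<open>S\<close>; it survives the removal of \<open>k\<close> from \<open>S\<close> when \<open>k\<close> is tied to a remaining
  \<open>i\<close>, that is, when \<open>axis i 1 - axis k 1\<close> is added to \<open>B\<close>.
\<close>

lemma card_orders_ge:
  fixes L :: "real ^ 'd::finite \<Rightarrow> 'a::euclidean_space"
  assumes "finite S" "S \<noteq> {}" and L: "linear L"
    and F: "\<And>i j. axis i 1 - axis j 1 \<in> F"
    and gen: "\<And>C b. C \<subseteq> F \<Longrightarrow> finite C \<Longrightarrow> card C \<le> m \<Longrightarrow> b \<in> span C \<Longrightarrow> L b = 0 \<Longrightarrow> b = 0"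
    and "B \<subseteq> F" "finite B" "card B + l \<le> m"
    and "\<And>b. b \<in> span B \<Longrightarrow> (\<And>j. j \<notin> S \<Longrightarrow> b $ j = 0) \<Longrightarrow> (\<Sum>j\<in>UNIV. b $ j) = 0 \<Longrightarrow> b = 0"
  shows "order_count (card S - 1) l \<le>
    card (orders (\<lambda>j. L (axis j 1)) S {c. \<forall>b\<in>B. L b \<bullet> c = 0})"
  using assms(1,2,6-9)
proof (induction S arbitrary: B l rule: finite_ne_induct)
  case (singleton x)
  have "[x] \<in> orders (\<lambda>j. L (axis j 1)) {x} {c. \<forall>b\<in>B. L b \<bullet> c = 0}"
    by (auto simp: orders_def intro: exI[of _ 0])
  then have "card (orders (\<lambda>j. L (axis j 1)) {x} {c. \<forall>b\<in>B. L b \<bullet> c = 0}) > 0"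
    using finite_orders[of "{x}"] by (auto simp: card_gt_0_iff)
  then show ?case by simp
next
  case (insert k S)
  let ?a = "\<lambda>j. L (axis j 1)"
  let ?e = "\<lambda>i. axis i 1 - axis k 1 :: real ^ 'd"
  let ?V = "\<lambda>B. {c. \<forall>b\<in>B. L b \<bullet> c = 0}"
  obtain n where n: "card S = Suc n" using insert by (metis card_0_eq not0_implies_Suc)
  show ?case
  proof (cases l)
    case 0
    then show ?thesis using insert n by simp
  next
    case (Suc l')
    have V: "subspace (?V B)"
      by (auto simp: subspace_def inner_add_right)
    \<comment> \<open>A tie on all of \<open>?V B\<close> puts \<open>L (?e i)\<close> into the
      double orthogonal complement of the image of \<open>span B\<close>, hence into that image. As
      \<open>l\<close> is positive, \<open>gen\<close> applies to \<open>insert (?e i) B\<close> and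
      gives \<open>?e i\<close> in \<open>span B\<close>, which the last assumption
      excludes.\<close>
    have cross: "\<exists>u\<in>?V B. (?a i - ?a k) \<bullet> u \<noteq> 0" if i: "i \<in> S" for i
    proof (rule ccontr)
      assume "\<not> ?thesis"
      then have "\<forall>u\<in>?V B. L (?e i) \<bullet> u = 0" unfolding linear_diff[OF L] by blast
      moreover have "(span (L ` B))\<^sup>\<bottom> \<subseteq> ?V B"
        by (auto simp: orthogonal_comp_def orthogonal_def span_base)
      ultimately have "L (?e i) \<in> (span (L ` B))\<^sup>\<bottom>\<^sup>\<bottom>"
        by (subst orthogonal_comp_def) (auto simp: orthogonal_def inner_commute)
      then have "L (?e i) \<in> L ` span B"
        unfolding orthogonal_comp_self[OF subspace_span] unfolding linear_span_image[OF L] .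
      then obtain b where b: "b \<in> span B" "L (?e i) = L b" by blast
      have "?e i - b = 0"
      proof (rule gen)
        show "insert (?e i) B \<subseteq> F" "finite (insert (?e i) B)" using F insert.prems by auto
        show "card (insert (?e i) B) \<le> m"
          using insert.prems Suc card_insert_le_m1[of "Suc (card B)" B "?e i"] by simp
        show "?e i - b \<in> span (insert (?e i) B)"
          using b(1) span_mono[OF subset_insertI[of B "?e i"]] by (intro span_diff[OF span_base]) auto
        show "L (?e i - b) = 0" using b(2) L by (simp add: linear_diff)
      qed
      then have "?e i \<in> span B" using b by simp
      then have "?e i = 0"
      proof (rule insert.prems(4))
        show "?e i $ j = 0" if "j \<notin> insert k S" for j using that i by (auto simp: axis_def)
        show "(\<Sum>j\<in>UNIV. ?e i $ j) = 0" by (simp add: axis_def sum_subtractf)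
      qed
      moreover have "?e i $ i = 1" using i insert.hyps by (auto simp: axis_def)
      ultimately show False by simp
    qed
    have "order_count n (Suc l') \<le> card (orders ?a S (?V B))"
      using insert.IH[of B l] insert.prems n Suc by auto
    moreover have "order_count n l' \<le> card (orders ?a S (?V B \<inter> {c. (?a i - ?a k) \<bullet> c = 0}))"
      if i: "i \<in> S" for i
    proof -
      \<comment> \<open>The tie with \<open>i\<close> becomes one more constraint, paid for by
        lowering \<open>l\<close> to \<open>l'\<close>.\<close>
      have "order_count (card S - 1) l' \<le> card (orders ?a S (?V (insert (?e i) B)))"
      proof (rule insert.IH)
        show "insert (?e i) B \<subseteq> F" "finite (insert (?e i) B)" using F insert.prems by auto
        show "card (insert (?e i) B) + l' \<le> m"
          using insert.prems Suc card_insert_le_m1[of "Suc (card B)" B "?e i"] by simp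
        fix b assume b: "b \<in> span (insert (?e i) B)" "\<And>j. j \<notin> S \<Longrightarrow> b $ j = 0" "(\<Sum>j\<in>UNIV. b $ j) = 0"
        then obtain t where t: "b - t *\<^sub>R ?e i \<in> span B" by (auto simp: span_insert)
        then have bt: "b - t *\<^sub>R ?e i = 0"
        proof (rule insert.prems(4))
          show "(b - t *\<^sub>R ?e i) $ j = 0" if "j \<notin> insert k S" for j
            using that i b(2)[of j] by (auto simp: axis_def)
          show "(\<Sum>j\<in>UNIV. (b - t *\<^sub>R ?e i) $ j) = 0"
            using b(3) by (simp add: axis_def sum_subtractf flip: sum_distrib_left)
        qed
        \<comment> \<open>The vector \<open>b\<close> vanishes at \<open>k\<close>, which has left
          the set, whereas \<open>?e i\<close> does not; this isolates \<open>t\<close>.\<close>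
        have "?e i $ k = - 1" using insert.hyps i by (auto simp: axis_def)
        then have "(b - t *\<^sub>R ?e i) $ k = t" using b(2)[of k] insert.hyps
          unfolding vector_minus_component[of b] vector_scaleR_component by simp
        then have "t = 0" using bt by simp
        then show "b = 0" using bt by simp
      qed
      moreover have "?V (insert (?e i) B) = ?V B \<inter> {c. (?a i - ?a k) \<bullet> c = 0}"
        using L by (auto simp: linear_diff)
      ultimately show ?thesis using n by simp
    qed
    then have "card S * order_count n l' \<le> (\<Sum>i\<in>S. card (orders ?a S (?V B \<inter> {c. (?a i - ?a k) \<bullet> c = 0})))"
      using sum_mono[of S "\<lambda>_. order_count n l'"] by simp
    ultimately have "order_count n (Suc l') + card S * order_count n l' \<le> card (orders ?a (insert k S) (?V B))"
      using card_orders_insert_ge[OF insert.hyps(1,3) V, where a = ?a, OF cross] by linarith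
    then show ?thesis using insert.hyps n Suc by simp
  qed
qed

section \<open>Tail bounds for the number of orderings\<close>

text \<open>Chernoff's bound for the probability that independent Bernoulli variables with
  parameters 1/2, ..., 1/(n+1), of total mean \<open>harm (Suc n) - 1\<close>, sum to at least n -
  l. The induction carries the exponential bound directly, without constructing the
  variables.\<close>

lemma order_count_upper:
  fixes t :: real
  assumes "t \<ge> 0"
  shows "real (order_count n l) \<le>
    fact (Suc n) * exp (t * real l - t * real n + (exp t - 1) * (harm (Suc n) - 1))"
proof (induction n l rule: order_count.induct)
  case (1 l)
  show ?case using assms by (simp add: harm_Suc harm_expand)
next
  case (2 n)
  then show ?case by simp
next
  case (3 n l)
  let ?h = "harm (Suc n) - 1 :: real" and ?k = "exp t - 1"
  let ?X = "exp (t * real (Suc l) - t * real n + ?k * ?h)"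
  let ?N = "real (Suc (Suc n))"
  \<comment> \<open>The moment generating function of one Bernoulli variable with parameter
    \<open>1 / ?N\<close> is bounded by \<open>exp (?k / ?N)\<close>.\<close>
  have "?k / ?N \<le> exp (?k / ?N) - 1" using exp_ge_add_one_self[of "?k / ?N"] by linarith
  then have *: "exp t + real (Suc n) \<le> ?N * exp (?k / ?N)"
    by (simp add: field_simps)
  have X: "exp (t * real l - t * real n + ?k * ?h) = ?X * exp (- t)"
    by (simp add: algebra_simps flip: exp_add)
  have "real (order_count (Suc n) (Suc l)) \<le> fact (Suc n) * ?X + real (Suc n) * (fact (Suc n) * (?X * exp (- t)))"
    using add_mono[OF 3(1) mult_left_mono[OF 3(2), of "real (Suc n)"]]
    by (simp only: X order_count.simps of_nat_add of_nat_mult)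
  also have "\<dots> = fact (Suc n) * (?X * exp (- t)) * (exp t + real (Suc n))"
    by (simp add: algebra_simps flip: exp_add)
  also have "\<dots> \<le> fact (Suc n) * (?X * exp (- t)) * (?N * exp (?k / ?N))"
    by (intro mult_left_mono *) auto
  also have "\<dots> = fact (Suc (Suc n)) * (?X * exp (- t) * exp (?k / ?N))"
    by (simp add: algebra_simps)
  also have "?X * exp (- t) * exp (?k / ?N) =
      exp (t * real (Suc l) - t * real (Suc n) + (exp t - 1) * (harm (Suc (Suc n)) - 1))"
    by (simp add: harm_Suc[of "Suc n"] field_simps flip: exp_add)
  finally show ?case .
qed

text \<open>The opposite tail, that the same Bernoulli variables sum to at most n - l, with the
  exponential moment taken at \<open>- t\<close>.\<close>

lemma order_count_lower:
  fixes t :: real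
  assumes "t \<ge> 0"
  shows "fact (Suc n) - real (order_count n l) \<le>
    fact (Suc n) * exp (t * real n - t * real l - (1 - exp (- t)) * (harm (Suc n) - 1))"
proof (induction n l rule: order_count.induct)
  case (1 l)
  show ?case by simp
next
  case (2 n)
  \<comment> \<open>The count is zero here, so the exponent must be shown to be nonnegative.\<close>
  have "harm (Suc (Suc n)) - 1 \<le> real (Suc n)"
  proof (induction n)
    case (Suc n)
    have "harm (Suc (Suc (Suc n))) = harm (Suc (Suc n)) + inverse (real (Suc (Suc (Suc n))))"
      by (simp add: harm_Suc)
    moreover have "inverse (real (Suc (Suc (Suc n)))) \<le> 1" by (simp add: field_simps)
    ultimately show ?case using Suc by simp
  qed (simp add: harm_Suc harm_expand)
  moreover have "0 \<le> harm (Suc (Suc n)) - (1::real)"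
    using harm_mono[of 1 "Suc (Suc n)"] by (simp add: harm_expand)
  moreover have "1 - exp (- t) \<le> t" using exp_ge_add_one_self[of "- t"] by simp
  moreover have "0 \<le> 1 - exp (- t)" using assms by simp
  ultimately have "(1 - exp (- t)) * (harm (Suc (Suc n)) - 1) \<le> t * real (Suc n)"
    using assms by (intro mult_mono) auto
  then show ?case by simp
next
  case (3 n l)
  let ?h = "harm (Suc n) - 1 :: real" and ?k = "1 - exp (- t)"
  let ?X = "exp (t * real n - t * real (Suc l) - ?k * ?h)"
  let ?N = "real (Suc (Suc n))"
  have "- ?k / ?N \<le> exp (- ?k / ?N) - 1" using exp_ge_add_one_self[of "- ?k / ?N"] by linarith
  then have *: "exp (- t) + real (Suc n) \<le> ?N * exp (- ?k / ?N)"
    by (simp add: field_simps)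
  have X: "exp (t * real n - t * real l - ?k * ?h) = ?X * exp t"
    by (simp add: algebra_simps flip: exp_add)
  have "fact (Suc (Suc n)) - real (order_count (Suc n) (Suc l)) =
     (fact (Suc n) - real (order_count n (Suc l))) + real (Suc n) * (fact (Suc n) - real (order_count n l))"
    by (simp add: algebra_simps)
  also have "\<dots> \<le> fact (Suc n) * ?X + real (Suc n) * (fact (Suc n) * (?X * exp t))"
    using add_mono[OF 3(1) mult_left_mono[OF 3(2), of "real (Suc n)"]]
    by (simp only: X)
  also have "\<dots> = fact (Suc n) * (?X * exp t) * (exp (- t) + real (Suc n))"
    by (simp add: algebra_simps flip: exp_add)
  also have "\<dots> \<le> fact (Suc n) * (?X * exp t) * (?N * exp (- ?k / ?N))"
    by (intro mult_left_mono *) auto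
  also have "\<dots> = fact (Suc (Suc n)) * (?X * exp t * exp (- ?k / ?N))"
    by (simp add: algebra_simps)
  also have "?X * exp t * exp (- ?k / ?N) =
      exp (t * real (Suc n) - t * real (Suc l) - (1 - exp (- t)) * (harm (Suc (Suc n)) - 1))"
    by (simp add: harm_Suc[of "Suc n"] field_simps flip: exp_add)
  finally show ?case .
qed

section \<open>Gaussian matrices in general position\<close>

definition std_normal :: "real measure" where
  "std_normal = density lborel std_normal_density"

lemma sets_std_normal [simp, measurable_cong]: "sets std_normal = sets borel"
  by (simp add: std_normal_def)

lemma space_std_normal [simp]: "space std_normal = UNIV"
  by (simp add: std_normal_def)

lemma prob_space_std_normal: "prob_space std_normal"
  unfolding std_normal_def by (rule prob_space_normal_density) simp

text \<open>The index set is arbitrary because injectivity of a Gaussian matrix is proved by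
  splitting off one row at a time.\<close>

definition gaussian :: "'k set \<Rightarrow> ('k \<Rightarrow> real) measure" where
  "gaussian K = PiM K (\<lambda>_. std_normal)"

lemma prob_space_gaussian: "prob_space (gaussian K)"
  unfolding gaussian_def by (intro prob_space_PiM prob_space_std_normal)

lemma space_gaussian: "space (gaussian K) = (\<Pi>\<^sub>E i\<in>K. UNIV)"
  by (simp add: gaussian_def space_PiM)

lemma measurable_gaussian_component:
  "k \<in> K \<Longrightarrow> (\<lambda>f. f k) \<in> borel_measurable (gaussian K)"
  unfolding gaussian_def using measurable_component_singleton[of k K "\<lambda>_. std_normal"]
  by (simp add: measurable_cong_sets[OF refl sets_std_normal])

text \<open>The sum is normal with positive variance, hence has a density and no atom at 0.\<close>

lemma AE_gaussian_sum_nonzero: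
  fixes u :: "'k \<Rightarrow> real"
  assumes K: "finite K" and k: "k \<in> K" "u k \<noteq> 0"
  shows "AE f in gaussian K. (\<Sum>i\<in>K. f i * u i) \<noteq> 0"
proof -
  interpret prob_space "gaussian K" by (rule prob_space_gaussian)
  \<comment> \<open>Zero coefficients are dropped, since each summand needs a positive standard
    deviation.\<close>
  let ?K = "{i\<in>K. u i \<noteq> 0}"
  have comp: "distr (gaussian K) borel (\<lambda>f. f i) = std_normal" if "i \<in> K" for i
  proof -
    have "distr (gaussian K) borel (\<lambda>f. f i) = distr (gaussian K) std_normal (\<lambda>f. f i)"
      by (rule distr_cong) simp_all
    also have "\<dots> = std_normal"
      unfolding gaussian_def by (rule distr_PiM_component) (use that prob_space_std_normal in auto)
    finally show ?thesis .
  qed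
  have "indep_vars (\<lambda>_. borel) (\<lambda>i f. f i) K"
  proof (subst indep_vars_iff_distr_eq_PiM')
    show "K \<noteq> {}" using k by auto
    show "(\<lambda>f. f i) \<in> borel_measurable (gaussian K)" if "i \<in> K" for i
      by (rule measurable_gaussian_component[OF that])
    have "distr (gaussian K) (PiM K (\<lambda>_. borel)) (\<lambda>f. \<lambda>i\<in>K. f i) = distr (gaussian K) (gaussian K) (\<lambda>f. f)"
      by (rule distr_cong) (auto simp: gaussian_def space_PiM intro!: sets_PiM_cong)
    also have "\<dots> = PiM K (\<lambda>i. distr (gaussian K) borel (\<lambda>f. f i))"
      unfolding distr_id by (subst gaussian_def) (rule PiM_cong[OF refl], simp add: comp)
    finally show "distr (gaussian K) (PiM K (\<lambda>_. borel)) (\<lambda>f. \<lambda>i\<in>K. f i) =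
      PiM K (\<lambda>i. distr (gaussian K) borel (\<lambda>f. f i))" .
  qed
  then have "indep_vars (\<lambda>_. borel) (\<lambda>i f. f i) ?K" by (rule indep_vars_subset) auto
  then have ind: "indep_vars (\<lambda>_. borel) (\<lambda>i f. 0 + u i * f i) ?K"
    by (rule indep_vars_compose2) simp
  have "distributed (gaussian K) lborel (\<lambda>f. \<Sum>i\<in>?K. 0 + u i * f i)
      (normal_density (\<Sum>i\<in>?K. 0 + u i * 0) (sqrt (\<Sum>i\<in>?K. (\<bar>u i\<bar> * 1)\<^sup>2)))"
  proof (rule sum_indep_normal[OF _ _ ind])
    fix i assume i: "i \<in> ?K"
    then show "0 < \<bar>u i\<bar> * 1" by simp
    have "distributed (gaussian K) lborel (\<lambda>f. f i) (normal_density 0 1)"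
      unfolding distributed_def
      using comp[of i] i measurable_gaussian_component[of i K]
      by (auto simp: std_normal_def cong: distr_cong)
    then show "distributed (gaussian K) lborel (\<lambda>f. 0 + u i * f i) (normal_density (0 + u i * 0) (\<bar>u i\<bar> * 1))"
      using i by (intro normal_density_affine) auto
  qed (use K k in auto)
  then have dist: "distr (gaussian K) lborel (\<lambda>f. \<Sum>i\<in>?K. 0 + u i * f i) = density lborel
      (normal_density (\<Sum>i\<in>?K. 0 + u i * 0) (sqrt (\<Sum>i\<in>?K. (\<bar>u i\<bar> * 1)\<^sup>2)))"
    and meas: "(\<lambda>f. \<Sum>i\<in>?K. 0 + u i * f i) \<in> measurable (gaussian K) lborel"
    by (auto simp: distributed_def)
  have "AE x in distr (gaussian K) lborel (\<lambda>f. \<Sum>i\<in>?K. 0 + u i * f i). x \<noteq> 0"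
    unfolding dist by (subst AE_density) (use AE_lborel_singleton[of "0::real"] in auto)
  then have "AE f in gaussian K. (\<Sum>i\<in>?K. 0 + u i * f i) \<noteq> 0"
    by (rule AE_distrD[OF meas])
  moreover have "(\<Sum>i\<in>?K. 0 + u i * f i) = (\<Sum>i\<in>K. f i * u i)" for f
    using K by (intro sum.mono_neutral_cong_left) (auto simp: mult.commute)
  ultimately show ?thesis by simp
qed

section \<open>Injectivity of Gaussian matrices on subspaces\<close>

text \<open>Rows outside \<open>I\<close> are zero, so the matrix type stays fixed while the set of
  rows grows by induction.\<close>

definition matrix_of :: "'m set \<Rightarrow> ('m \<times> 'd \<Rightarrow> real) \<Rightarrow> real ^ 'd ^ 'm" where
  "matrix_of I f = (\<chi> i j. if i \<in> I then f (i, j) else 0)"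

lemma measurable_matrixI:
  fixes G :: "'a \<Rightarrow> real ^ 'd::finite ^ 'm::finite"
  assumes "\<And>i j. (\<lambda>x. G x $ i $ j) \<in> borel_measurable M"
  shows "G \<in> borel_measurable M"
proof (rule borel_measurable_euclidean_space[THEN iffD2], rule ballI)
  fix b :: "real ^ 'd ^ 'm" assume "b \<in> Basis"
  then obtain i j where "b = axis i (axis j 1)" unfolding Basis_vec_def by auto
  then have "(\<lambda>x. G x \<bullet> b) = (\<lambda>x. G x $ i $ j)" by (simp add: inner_axis)
  then show "(\<lambda>x. G x \<bullet> b) \<in> borel_measurable M" using assms by simp
qed

lemma measurable_matrix_of [measurable]:
  fixes I :: "'m::finite set"
  shows "(matrix_of I :: _ \<Rightarrow> real ^ 'd::finite ^ 'm) \<in> borel_measurable (gaussian (I \<times> UNIV))"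
proof (rule measurable_matrixI)
  fix i j
  show "(\<lambda>x. matrix_of I x $ i $ j :: real) \<in> borel_measurable (gaussian (I \<times> UNIV))"
    by (cases "i \<in> I") (auto simp: matrix_of_def intro: measurable_gaussian_component)
qed

text \<open>By scaling, failure is witnessed on the compact unit sphere of \<open>W\<close>, so the
  bad matrices are the projection of a closed set along a compact factor. This yields the
  measurability needed for Fubini.\<close>

lemma open_injective_matrices:
  fixes W :: "(real ^ 'd::finite) set"
  assumes W: "subspace W"
  shows "open {G :: real ^ 'd ^ 'm::finite. \<forall>b\<in>W. G *v b = 0 \<longrightarrow> b = 0}"
proof -
  let ?T = "{p :: (real ^ 'd) \<times> (real ^ 'd ^ 'm). snd p *v fst p = 0}"
  let ?S = "W \<inter> sphere 0 1"
  have "compact ?S" using W by (intro closed_Int_compact closed_subspace compact_sphere)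
  moreover have "closed ?T"
    unfolding matrix_vector_mult_def vec_eq_iff
    by (simp, intro closed_Collect_all closed_Collect_eq continuous_intros)
  ultimately have "closed {G. \<exists>b. b \<in> ?S \<and> (b, G) \<in> ?T}" by (rule closed_compact_projection)
  moreover have "{G. \<exists>b. b \<in> ?S \<and> (b, G) \<in> ?T} = - {G. \<forall>b\<in>W. G *v b = 0 \<longrightarrow> b = 0}"
  proof (intro equalityI subsetI)
    fix G assume "G \<in> - {G :: real ^ 'd ^ 'm. \<forall>b\<in>W. G *v b = 0 \<longrightarrow> b = 0}"
    then obtain b where b: "b \<in> W" "G *v b = 0" "b \<noteq> 0" by auto
    then have "(1 / norm b) *\<^sub>R b \<in> ?S" "G *v ((1 / norm b) *\<^sub>R b) = 0"
      using W by (auto intro: subspace_scale simp: matrix_vector_mult_scaleR)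
    then show "G \<in> {G. \<exists>b. b \<in> ?S \<and> (b, G) \<in> ?T}" by (intro CollectI exI[of _ "(1 / norm b) *\<^sub>R b"]) simp
  qed auto
  ultimately show ?thesis by (simp add: open_closed)
qed

text \<open>Induction on the rows: almost surely a new row does not vanish on \<open>W\<close>, so
  its kernel cuts \<open>W\<close> down in dimension and the remaining rows suffice by
  Fubini.\<close>

lemma AE_gaussian_injective_on:
  fixes W :: "(real ^ 'd::finite) set" and I :: "'m::finite set"
  assumes "subspace W" "dim W \<le> card I"
  shows "AE f in gaussian (I \<times> UNIV). \<forall>b\<in>W. matrix_of I f *v b = 0 \<longrightarrow> b = 0"
proof -
  have "finite I" by simp
  then show ?thesis using assms
  proof (induction I arbitrary: W rule: finite_induct)
    case empty
    then show ?case by auto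
  next
    case (insert i I)
    let ?J = "{i} \<times> (UNIV :: 'd set)" and ?I = "I \<times> (UNIV :: 'd set)"
    let ?Q = "\<lambda>f. \<forall>b\<in>W. matrix_of (insert i I) f *v b = 0 \<longrightarrow> b = 0"
    interpret product_sigma_finite "\<lambda>_ :: 'm \<times> 'd. std_normal"
      using prob_space_std_normal by (simp add: product_sigma_finite_def prob_space_imp_sigma_finite)
    interpret J: prob_space "gaussian ?J" by (rule prob_space_gaussian)
    interpret I: prob_space "gaussian ?I" by (rule prob_space_gaussian)
    interpret P: pair_sigma_finite "gaussian ?J" "gaussian ?I" ..
    have un: "?J \<union> ?I = insert i I \<times> UNIV" by auto
    have mrg: "merge ?J ?I \<in> measurable (gaussian ?J \<Otimes>\<^sub>M gaussian ?I) (gaussian (insert i I \<times> UNIV))"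
      unfolding gaussian_def un[symmetric] by (rule measurable_merge)
    have D: "distr (gaussian ?J \<Otimes>\<^sub>M gaussian ?I) (gaussian (insert i I \<times> UNIV)) (merge ?J ?I) =
        gaussian (insert i I \<times> UNIV)"
      unfolding gaussian_def un[symmetric] by (rule distr_merge) (use insert.hyps in auto)
    have meas: "{f \<in> space (gaussian (insert i I \<times> UNIV)). ?Q f} \<in> sets (gaussian (insert i I \<times> UNIV))"
    proof -
      have "matrix_of (insert i I) -` {G :: real ^ 'd ^ 'm. \<forall>b\<in>W. G *v b = 0 \<longrightarrow> b = 0} \<inter>
          space (gaussian (insert i I \<times> UNIV)) \<in> sets (gaussian (insert i I \<times> UNIV))"
        by (rule measurable_sets[OF measurable_matrix_of])
          (rule borel_open[OF open_injective_matrices[OF insert.prems(1)]])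
      then show ?thesis by (rule back_subst[of "\<lambda>A. A \<in> _"]) auto
    qed
    have pair_image: "?J = Pair i ` UNIV" by auto
    have all_split: "(\<forall>r. P r) \<longleftrightarrow> P i \<and> (\<forall>r. r \<noteq> i \<longrightarrow> P r)" for P :: "'m \<Rightarrow> bool"
      by metis
    \<comment> \<open>With the new row \<open>g\<close> fixed, injectivity on \<open>W\<close> means
      injectivity of the other rows on the part of \<open>W\<close> that \<open>g\<close>
      annihilates.\<close>
    have split: "?Q (merge ?J ?I (g, h)) \<longleftrightarrow>
        (\<forall>b\<in>W \<inter> {b. (\<Sum>p\<in>?J. g p * b $ snd p) = 0}. matrix_of I h *v b = 0 \<longrightarrow> b = 0)" for g h
    proof -
      have "matrix_of (insert i I) (merge ?J ?I (g, h)) *v b = 0 \<longleftrightarrow>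
        (\<Sum>p\<in>?J. g p * b $ snd p) = 0 \<and> matrix_of I h *v b = 0" for b :: "real ^ 'd"
      proof -
        have 1: "(\<Sum>p\<in>?J. g p * b $ snd p) = (\<Sum>j\<in>UNIV. g (i, j) * b $ j)"
          unfolding pair_image by (simp add: sum.reindex inj_on_def)
        have 2: "(matrix_of (insert i I) (merge ?J ?I (g, h)) *v b) $ i = (\<Sum>j\<in>UNIV. g (i, j) * b $ j)"
          by (simp add: matrix_vector_mult_def matrix_of_def merge_def)
        have 3: "(matrix_of (insert i I) (merge ?J ?I (g, h)) *v b) $ r = (matrix_of I h *v b) $ r"
          if "r \<noteq> i" for r
          using that by (auto simp: matrix_vector_mult_def matrix_of_def merge_def intro!: sum.cong)
        have 4: "(matrix_of I h *v b) $ i = 0"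
          using insert.hyps by (simp add: matrix_vector_mult_def matrix_of_def)
        have "matrix_of (insert i I) (merge ?J ?I (g, h)) *v b = 0 \<longleftrightarrow>
            (matrix_of (insert i I) (merge ?J ?I (g, h)) *v b) $ i = 0 \<and>
            (\<forall>r. r \<noteq> i \<longrightarrow> (matrix_of (insert i I) (merge ?J ?I (g, h)) *v b) $ r = 0)"
          unfolding vec_eq_iff zero_index by (rule all_split)
        also have "\<dots> \<longleftrightarrow> (\<Sum>j\<in>UNIV. g (i, j) * b $ j) = 0 \<and>
            (\<forall>r. r \<noteq> i \<longrightarrow> (matrix_of I h *v b) $ r = 0)"
          unfolding 2 using 3 by metis
        also have "(\<forall>r. r \<noteq> i \<longrightarrow> (matrix_of I h *v b) $ r = 0) \<longleftrightarrow> matrix_of I h *v b = 0"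
          by (metis 4 vec_eq_iff zero_index)
        finally show ?thesis unfolding 1 .
      qed
      then show ?thesis by blast
    qed
    have AEg: "AE g in gaussian ?J. AE h in gaussian ?I. ?Q (merge ?J ?I (g, h))"
    proof (cases "W = {0}")
      case True
      then show ?thesis by simp
    next
      case False
      \<comment> \<open>A single nonzero vector of \<open>W\<close> not annihilated by the row makes
        the kernel section a proper subspace.\<close>
      then obtain u where u: "u \<in> W" "u \<noteq> 0" using subspace_0[OF insert.prems(1)] by blast
      then obtain j where "u $ j \<noteq> 0" by (auto simp: vec_eq_iff)
      then have nz: "AE g in gaussian ?J. (\<Sum>p\<in>?J. g p * u $ snd p) \<noteq> 0"
        by (intro AE_gaussian_sum_nonzero[of _ "(i, j)"]) auto
      show ?thesis
      proof (rule AE_mp[OF nz], rule AE_I2, rule impI)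
        fix g assume g: "(\<Sum>p\<in>?J. g p * u $ snd p) \<noteq> 0"
        let ?W = "W \<inter> {b. (\<Sum>p\<in>?J. g p * b $ snd p) = 0}"
        have "linear (\<lambda>b :: real ^ 'd. \<Sum>p\<in>?J. g p * b $ snd p)"
          by (intro linear_compose_sum ballI)
            (auto intro!: linearI simp: algebra_simps)
        then have "subspace {b :: real ^ 'd. (\<Sum>p\<in>?J. g p * b $ snd p) = 0}"
          by (rule linear_subspace_kernel)
        then have sub: "subspace ?W" using insert.prems(1) by (intro subspace_inter)
        have "?W \<subset> W" using u g by auto
        then have "dim ?W < dim W"
          using dim_psubset[of ?W W] sub insert.prems(1) by (simp add: span_eq_iff[THEN iffD2])
        then have "dim ?W \<le> card I" using insert by simp
        from insert.IH[OF sub this] show "AE h in gaussian ?I. ?Q (merge ?J ?I (g, h))"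
          unfolding split .
      qed
    qed
    have "AE x in gaussian ?J \<Otimes>\<^sub>M gaussian ?I. ?Q (merge ?J ?I x)"
    proof (rule P.AE_pair_measure[OF _ AEg])
      have "merge ?J ?I -` {f \<in> space (gaussian (insert i I \<times> UNIV)). ?Q f} \<inter>
        space (gaussian ?J \<Otimes>\<^sub>M gaussian ?I) \<in> sets (gaussian ?J \<Otimes>\<^sub>M gaussian ?I)"
        by (rule measurable_sets[OF mrg meas])
      then show "{x \<in> space (gaussian ?J \<Otimes>\<^sub>M gaussian ?I). ?Q (merge ?J ?I x)} \<in>
          sets (gaussian ?J \<Otimes>\<^sub>M gaussian ?I)"
        by (rule back_subst[of "\<lambda>A. A \<in> _"]) (use measurable_space[OF mrg] in auto)
    qed
    then have "AE f in distr (gaussian ?J \<Otimes>\<^sub>M gaussian ?I) (gaussian (insert i I \<times> UNIV)) (merge ?J ?I). ?Q f"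
      using mrg meas by (subst AE_distr_iff) auto
    then show ?case unfolding D .
  qed
qed

section \<open>Success of the program as a separation property\<close>

lemma permute_coords_permute_coords:
  "permute_coords \<sigma> (permute_coords \<tau> x) = permute_coords (\<tau> \<circ> \<sigma>) x"
  by (simp add: permute_coords_def)

lemma permute_coords_id: "permute_coords id x = x"
  by (simp add: permute_coords_def)

lemma permutahedron_permute_coords:
  assumes "\<tau> permutes UNIV"
  shows "permutahedron (permute_coords \<tau> x) = permutahedron x"
proof -
  have "{permute_coords \<sigma> (permute_coords \<tau> x) | \<sigma>. \<sigma> permutes UNIV} = {permute_coords \<sigma> x | \<sigma>. \<sigma> permutes UNIV}"
  proof (intro equalityI subsetI; clarify)
    fix \<sigma> :: "'a \<Rightarrow> 'a" assume s: "\<sigma> permutes UNIV"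
    show "\<exists>\<rho>. permute_coords \<sigma> (permute_coords \<tau> x) = permute_coords \<rho> x \<and> \<rho> permutes UNIV"
      using permutes_compose[OF s assms] permute_coords_permute_coords by blast
    have "permute_coords \<sigma> x = permute_coords (inv \<tau> \<circ> \<sigma>) (permute_coords \<tau> x)"
      using permutes_inv_o[OF assms] by (simp add: permute_coords_permute_coords flip: o_assoc)
        (simp add: o_assoc)
    then show "\<exists>\<rho>. permute_coords \<sigma> x = permute_coords \<rho> (permute_coords \<tau> x) \<and> \<rho> permutes UNIV"
      using permutes_compose[OF s permutes_inv[OF assms]] by blast
  qed
  then show ?thesis by (simp add: permutahedron_def)
qed

text \<open>Removes sorting from the problem: the objective depends only on the orbit of
  \<open>x\<close>.\<close>

lemma permutahedron_sort_decreasing: "permutahedron (sort_decreasing x) = permutahedron x"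
  using sort_decreasing_permutation[of x] permutahedron_permute_coords by metis

lemma inner_permute_coords:
  fixes x y :: "real ^ 'd::finite"
  assumes "\<sigma> permutes UNIV"
  shows "permute_coords \<sigma> x \<bullet> permute_coords \<sigma> y = x \<bullet> y"
  using sum.permute[OF assms, of "\<lambda>i. x $ i * y $ i"]
  by (simp add: inner_vec_def permute_coords_def o_def)

lemma norm_permute_coords:
  fixes x :: "real ^ 'd::finite"
  shows "\<sigma> permutes UNIV \<Longrightarrow> norm (permute_coords \<sigma> x) = norm x"
  by (simp add: norm_eq_sqrt_inner inner_permute_coords)

lemma norm_permutahedron_le:
  fixes x :: "real ^ 'd::finite"
  assumes "p \<in> permutahedron x"
  shows "norm p \<le> norm x"
proof -
  have "permutahedron x \<subseteq> cball 0 (norm x)"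
    unfolding permutahedron_def by (rule hull_minimal) (auto simp: norm_permute_coords)
  then show ?thesis using assms by auto
qed

lemma self_in_permutahedron: "x \<in> permutahedron x"
  unfolding permutahedron_def
  by (rule hull_inc) (auto intro!: exI[of _ id] simp: permute_coords_id permutes_id)

section \<open>The gauge of the permutahedron and its unit level set\<close>

lemma minkowski_gauge_le:
  assumes "t > 0" "v \<in> K"
  shows "minkowski_gauge K (t *\<^sub>R v) \<le> ereal t"
  unfolding minkowski_gauge_def using assms by (intro Inf_lower) auto

text \<open>The infimum need not be attained, so \<open>x\<close> is divided by factors slightly
  above 1; convexity with 0 puts the quotients into \<open>K\<close>, and closedness their
  limit.\<close>

lemma minkowski_gauge_le_oneD:
  fixes K P :: "'a::real_normed_vector set"
  assumes K: "closed K" "convex K" "0 \<in> K" and "P \<subseteq> K" and g: "minkowski_gauge P x \<le> 1"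
  shows "x \<in> K"
proof -
  let ?r = "\<lambda>n. 1 + 1 / real (Suc n)"
  have "(1 / ?r n) *\<^sub>R x \<in> K" for n
  proof -
    have "minkowski_gauge P x < ereal (?r n)"
      by (rule le_less_trans[OF g]) simp
    then obtain t v where t: "t > 0" "t < ?r n" "v \<in> P" "x = t *\<^sub>R v"
      by (auto simp: minkowski_gauge_def Inf_less_iff)
    have "(t / ?r n) *\<^sub>R v + (1 - t / ?r n) *\<^sub>R 0 \<in> K"
    proof (rule convexD[OF K(2)])
      have "0 < ?r n" by (simp add: add_pos_pos)
      then show "0 \<le> t / ?r n" "0 \<le> 1 - t / ?r n" using t by (simp_all del: of_nat_Suc)
    qed (use t \<open>P \<subseteq> K\<close> K in auto)
    then show ?thesis using t(4) by simp
  qed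
  moreover have "(\<lambda>n. (1 / ?r n) *\<^sub>R x) \<longlonglongrightarrow> (1 / (1 + 0)) *\<^sub>R x"
    by (intro tendsto_intros LIMSEQ_Suc[OF lim_const_over_n]) simp
  ultimately have "(1 / (1 + 0)) *\<^sub>R x \<in> K" by (rule closed_sequentially[OF K(1)])
  then show ?thesis by simp
qed

text \<open>All vertices have the norm of \<open>x\<close>, so the permutahedron lies in the ball of
  that radius.\<close>

lemma one_le_minkowski_gauge_permutahedron:
  fixes x :: "real ^ 'd::finite"
  assumes "x \<noteq> 0"
  shows "1 \<le> minkowski_gauge (permutahedron x) x"
  unfolding minkowski_gauge_def
proof (rule Inf_greatest)
  fix e assume "e \<in> ereal ` {\<tau>. \<tau> > 0 \<and> x \<in> (*\<^sub>R) \<tau> ` permutahedron x}"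
  then obtain t v where t: "e = ereal t" "t > 0" "v \<in> permutahedron x" "x = t *\<^sub>R v" by auto
  have "norm x = t * norm v" using t by simp
  also have "\<dots> \<le> t * norm x"
    using t(2) norm_permutahedron_le[OF t(3)] by (intro mult_left_mono) auto
  finally show "1 \<le> e" using assms t by simp
qed

text \<open>
  The union of all \<open>\<tau> P\<close> with \<open>0 \<le> \<tau> \<le> 1\<close>. It is larger than the permutahedron \<open>P\<close> when the
  entries of \<open>x\<close> do not sum to \<open>0\<close>.
\<close>

definition zero_permutahedron :: "real ^ 'd \<Rightarrow> (real ^ 'd) set" where
  "zero_permutahedron x = convex hull (insert 0 {permute_coords \<sigma> x | \<sigma>. \<sigma> permutes UNIV})"

lemma finite_permute_coords: "finite {permute_coords \<sigma> (x :: real ^ 'd::finite) | \<sigma>. \<sigma> permutes UNIV}"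
  by (simp add: setcompr_eq_image finite_permutations)

lemma zero_permutahedronE:
  assumes "z \<in> zero_permutahedron x"
  obtains v b where "0 \<le> v" "v \<le> 1" "b \<in> permutahedron x" "z = v *\<^sub>R b"
proof -
  have "{permute_coords \<sigma> x | \<sigma>. \<sigma> permutes UNIV} \<noteq> {}" using permutes_id by blast
  from assms[unfolded zero_permutahedron_def convex_hull_insert[OF this]] that
  show ?thesis unfolding permutahedron_def[symmetric] by auto
qed

text \<open>Gauge at most 1 forces membership in \<open>zero_permutahedron x\<close>, so success
  means that the feasible affine space meets this set only in \<open>x\<close>.\<close>

lemma program_succeeds_iff:
  fixes A :: "(real, 'd::{finite,linorder}) vec ^ 'm"
  shows "program_succeeds x A \<longleftrightarrow> (\<forall>z\<in>zero_permutahedron x. A *v (z - x) = 0 \<longrightarrow> z = x)"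
proof
  let ?g = "minkowski_gauge (permutahedron x)"
  assume R: "\<forall>z\<in>zero_permutahedron x. A *v (z - x) = 0 \<longrightarrow> z = x"
  have le: "z \<in> zero_permutahedron x" if "?g z \<le> 1" for z
  proof (rule minkowski_gauge_le_oneD[OF _ _ _ _ that])
    show "closed (zero_permutahedron x)" unfolding zero_permutahedron_def
      by (intro compact_imp_closed finite_imp_compact_convex_hull) (simp add: finite_permute_coords)
    show "permutahedron x \<subseteq> zero_permutahedron x"
      unfolding permutahedron_def zero_permutahedron_def by (intro hull_mono) auto
  qed (auto simp: zero_permutahedron_def hull_inc)
  have x1: "?g x \<le> 1"
    using minkowski_gauge_le[OF zero_less_one self_in_permutahedron[of x]] by (simp add: one_ereal_def)
  have *: "z = x" if "A *v x = A *v z" "?g z \<le> ?g x" for z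
    using R le[of z] x1 that by (auto simp: matrix_vector_mult_diff_distrib)
  show "program_succeeds x A"
    unfolding program_succeeds_def gauge_program_minimizers_def permutahedron_sort_decreasing is_arg_min_def
  proof (intro equalityI subsetI)
    fix z assume "z \<in> {z. A *v x = A *v z \<and> \<not> (\<exists>y. A *v x = A *v y \<and> ?g y < ?g z)}"
    then show "z \<in> {x}" using *[of z] by (auto simp: not_less)
  next
    fix z assume "z \<in> {x}"
    moreover have "\<not> ?g y < ?g x" if "A *v x = A *v y" for y
      using *[OF that] by (metis less_imp_le order_less_irrefl)
    ultimately show "z \<in> {z. A *v x = A *v z \<and> \<not> (\<exists>y. A *v x = A *v y \<and> ?g y < ?g z)}" by auto
  qed
next
  let ?g = "minkowski_gauge (permutahedron x)"
  assume "program_succeeds x A"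
  then have S: "{z. is_arg_min ?g (\<lambda>z. A *v x = A *v z) z} = {x}"
    by (simp add: program_succeeds_def gauge_program_minimizers_def permutahedron_sort_decreasing)
  show "\<forall>z\<in>zero_permutahedron x. A *v (z - x) = 0 \<longrightarrow> z = x"
  proof (intro ballI impI)
    fix z assume z: "z \<in> zero_permutahedron x" "A *v (z - x) = 0"
    obtain v b where b: "0 \<le> v" "v \<le> 1" "b \<in> permutahedron x" "z = v *\<^sub>R b"
      using zero_permutahedronE[OF z(1)] .
    show "z = x"
    proof (cases "x = 0")
      case True
      then show ?thesis using norm_permutahedron_le[OF b(3)] b(4) by simp
    next
      case False
      \<comment> \<open>The gauge of \<open>z\<close> is infinite if \<open>z\<close> is 0 and 0 is
        outside the permutahedron. The midpoint of \<open>z\<close> and \<open>x\<close> avoids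
        this: it equals \<open>t *\<^sub>R y\<close> with \<open>t\<close> positive and
        \<open>y\<close> in the permutahedron.\<close>
      define t where "t = (v + 1) / 2"
      define y where "y = (v / (2 * t)) *\<^sub>R b + (1 / (2 * t)) *\<^sub>R x"
      have t: "0 < t" "t \<le> 1" using b by (auto simp: t_def)
      have "y \<in> permutahedron x" unfolding y_def
      proof (rule convexD)
        show "v / (2 * t) + 1 / (2 * t) = 1" using t by (simp add: t_def add_divide_distrib[symmetric] add.commute)
      qed (use b t self_in_permutahedron in \<open>auto simp: permutahedron_def convex_convex_hull\<close>)
      then have "?g (t *\<^sub>R y) \<le> ereal t" using t by (intro minkowski_gauge_le)
      also have "\<dots> \<le> 1" using t by simp
      also have "\<dots> \<le> ?g x" by (rule one_le_minkowski_gauge_permutahedron[OF False])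
      finally have gy: "?g (t *\<^sub>R y) \<le> ?g x" .
      have ty: "t *\<^sub>R y = (1/2) *\<^sub>R z + (1/2) *\<^sub>R x"
        using t by (simp add: y_def b(4) scaleR_add_right)
      have "A *v (t *\<^sub>R y) = (1/2) *\<^sub>R (A *v z) + (1/2) *\<^sub>R (A *v x)"
        unfolding ty by (simp add: matrix_vector_right_distrib matrix_vector_mult_scaleR)
      also have "A *v z = A *v x" using z(2) by (simp add: matrix_vector_mult_diff_distrib)
      finally have "A *v (t *\<^sub>R y) = A *v x" by (simp flip: scaleR_left_distrib)
      moreover have "is_arg_min ?g (\<lambda>z. A *v x = A *v z) x" using S by blast
      ultimately have "is_arg_min ?g (\<lambda>z. A *v x = A *v z) (t *\<^sub>R y)"
        using gy by (auto simp: is_arg_min_def dest: less_le_trans)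
      then have "t *\<^sub>R y = x" using S by blast
      then have "(1/2) *\<^sub>R z = (1/2) *\<^sub>R x" unfolding ty
        by (metis add_diff_cancel_right' scaleR_half_double scaleR_right_distrib)
      then show ?thesis by simp
    qed
  qed
qed

text \<open>An open half-space stays convex when one boundary point is added; strict separation of
  the vertices thus passes to all points of the hull except \<open>x\<close>.\<close>

lemma convex_insert_halfspace_lt:
  fixes w :: "'a::real_inner"
  shows "convex (insert x {z. w \<bullet> z < w \<bullet> x})"
proof (rule convexI)
  fix y z and u v :: real
  assume yz: "y \<in> insert x {z. w \<bullet> z < w \<bullet> x}" "z \<in> insert x {z. w \<bullet> z < w \<bullet> x}"
    and uv: "0 \<le> u" "0 \<le> v" "u + v = 1"
  have le: "w \<bullet> y \<le> w \<bullet> x" "w \<bullet> z \<le> w \<bullet> x" using yz by auto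
  have wx: "w \<bullet> x = u * (w \<bullet> x) + v * (w \<bullet> x)" using uv by (simp flip: distrib_right)
  consider "u = 0" | "v = 0" | "0 < u" "0 < v" using uv by linarith
  then show "u *\<^sub>R y + v *\<^sub>R z \<in> insert x {z. w \<bullet> z < w \<bullet> x}"
  proof cases
    case 3
    show ?thesis
    proof (cases "y = x \<and> z = x")
      case True
      then show ?thesis using uv by (simp flip: scaleR_left_distrib)
    next
      case False
      then have "w \<bullet> y < w \<bullet> x \<or> w \<bullet> z < w \<bullet> x" using yz by auto
      then have "u * (w \<bullet> y) + v * (w \<bullet> z) < u * (w \<bullet> x) + v * (w \<bullet> x)"
        using 3 le by (auto intro: add_less_le_mono add_le_less_mono)
      then show ?thesis using wx by (simp add: inner_add_right)
    qed
  qed (use uv yz in auto)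
qed

text \<open>Duality: \<open>c\<close> is a certificate whose row-space vector \<open>c v* A\<close>
  is maximised over \<open>zero_permutahedron x\<close> only at \<open>x\<close>. It exists because
  0 can be strictly separated from a compact polytope.\<close>

lemma program_succeeds_iff_separating:
  fixes A :: "(real, 'd::{finite,linorder}) vec ^ 'm"
  assumes x: "x \<noteq> 0"
  shows "program_succeeds x A \<longleftrightarrow>
    (\<exists>c. 0 < c \<bullet> (A *v x) \<and>
      (\<forall>\<sigma>. \<sigma> permutes UNIV \<longrightarrow> permute_coords \<sigma> x \<noteq> x \<longrightarrow> c \<bullet> (A *v permute_coords \<sigma> x) < c \<bullet> (A *v x)))"
    (is "_ \<longleftrightarrow> (\<exists>c. ?sep c)")
proof
  assume "\<exists>c. ?sep c"
  then obtain c where c: "?sep c" ..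
  have "zero_permutahedron x \<subseteq> insert x {z. (c v* A) \<bullet> z < (c v* A) \<bullet> x}"
    unfolding zero_permutahedron_def
    by (rule hull_minimal[where S = convex, OF _ convex_insert_halfspace_lt]) (use c in \<open>auto simp: dot_lmul_matrix\<close>)
  then show "program_succeeds x A" unfolding program_succeeds_iff
    by (force simp: dot_lmul_matrix matrix_vector_mult_diff_distrib)
next
  assume S: "program_succeeds x A"
  \<comment> \<open>Differences to \<open>x\<close> of the points generating the hull: 0 and the
    permutations other than \<open>x\<close>.\<close>
  let ?G = "insert (- x) {permute_coords \<sigma> x - x | \<sigma>. \<sigma> permutes UNIV \<and> permute_coords \<sigma> x \<noteq> x}"
  let ?C = "convex hull ((*v) A ` ?G)"
  have finG: "finite ?G"
    by (rule finite_subset[of _ "insert (- x) ((\<lambda>p. p - x) ` {permute_coords \<sigma> x | \<sigma>. \<sigma> permutes UNIV})"])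
      (auto simp: finite_permute_coords)
  \<comment> \<open>A null vector \<open>u\<close> in the hull of \<open>?G\<close> is nonzero,
    since all permutations share the norm of \<open>x\<close> and hence
    \<open>x \<bullet> u < 0\<close>; then \<open>x + u\<close> is a second feasible point.\<close>
  have "0 \<notin> ?C"
  proof
    assume "0 \<in> ?C"
    then have "0 \<in> (*v) A ` (convex hull ?G)"
      unfolding convex_hull_linear_image[OF matrix_vector_mul_linear] .
    then obtain u where u: "u \<in> convex hull ?G" "A *v u = 0" by force
    have "convex hull ?G \<subseteq> {u. x \<bullet> u < 0}"
    proof (rule hull_minimal)
      have "x \<bullet> permute_coords \<sigma> x < x \<bullet> x" if "\<sigma> permutes UNIV" "permute_coords \<sigma> x \<noteq> x" for \<sigma>
      proof -
        have "0 < (permute_coords \<sigma> x - x) \<bullet> (permute_coords \<sigma> x - x)" using that by simp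
        also have "\<dots> = 2 * (x \<bullet> x) - 2 * (x \<bullet> permute_coords \<sigma> x)"
          by (simp add: inner_diff_left inner_diff_right inner_commute inner_permute_coords[OF that(1)])
        finally show ?thesis by simp
      qed
      then show "?G \<subseteq> {u. x \<bullet> u < 0}" using x by (auto simp: inner_diff_right)
    qed (rule convex_halfspace_lt)
    then have "u \<noteq> 0" using u by auto
    have "x + u \<in> (+) x ` (convex hull ?G)" using u by blast
    also have "\<dots> = convex hull ((+) x ` ?G)" by (rule convex_hull_translation[symmetric])
    also have "\<dots> \<subseteq> zero_permutahedron x"
      unfolding zero_permutahedron_def by (rule hull_mono) auto
    finally show False using S u \<open>u \<noteq> 0\<close> unfolding program_succeeds_iff by force
  qed
  moreover have "closed ?C"
    by (intro compact_imp_closed finite_imp_compact_convex_hull finite_imageI finG)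
  ultimately obtain a b where "0 < b" "\<And>z. z \<in> ?C \<Longrightarrow> b < a \<bullet> z"
    using separating_hyperplane_closed_0[of ?C] by (auto simp: convex_convex_hull)
  then have "0 < a \<bullet> (A *v g)" if "g \<in> ?G" for g
    using that hull_inc[of "A *v g" "(*v) A ` ?G" convex] by force
  then have pos: "0 < a \<bullet> (A *v - x)"
    "\<And>\<sigma>. \<sigma> permutes UNIV \<Longrightarrow> permute_coords \<sigma> x \<noteq> x \<Longrightarrow> 0 < a \<bullet> (A *v (permute_coords \<sigma> x - x))"
    by blast+
  then have "?sep (- a)"
    using linear_neg[OF matrix_vector_mul_linear, of A x]
    by (auto simp: matrix_vector_mult_diff_distrib inner_diff_right)
  then show "\<exists>c. ?sep c" ..
qed

section \<open>Success of the program in terms of orderings\<close>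

text \<open>The image of the elements below \<open>i\<close> lies below \<open>\<tau> i\<close>, so
  no rank decreases; the ranks have the same total after reindexing, so none changes.\<close>

lemma order_automorphism_trivial:
  fixes x :: "'d::finite \<Rightarrow> 'a::linorder"
  assumes inj: "inj x" and \<tau>: "bij \<tau>" and mono: "\<And>i j. x i < x j \<Longrightarrow> x (\<tau> i) < x (\<tau> j)"
  shows "\<tau> i = i"
proof -
  let ?r = "\<lambda>i. card {j. x j < x i}"
  have less: "?r i < ?r k" if "x i < x k" for i k
    by (rule psubset_card_mono) (use that in auto)
  have "?r i \<le> ?r (\<tau> i)" for i
  proof -
    have "?r i = card (\<tau> ` {j. x j < x i})"
      by (rule card_image[symmetric]) (use \<tau> in \<open>auto simp: bij_def inj_on_def\<close>)
    also have "\<dots> \<le> ?r (\<tau> i)" by (rule card_mono) (auto intro: mono)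
    finally show ?thesis .
  qed
  moreover have "sum ?r UNIV = sum (\<lambda>i. ?r (\<tau> i)) UNIV"
    using sum.reindex_bij_betw[OF \<tau>, of ?r] by simp
  ultimately have "?r i = ?r (\<tau> i)" by (intro sum_mono_inv[of ?r UNIV "\<lambda>i. ?r (\<tau> i)"]) auto
  then have "x (\<tau> i) = x i" using less[of i "\<tau> i"] less[of "\<tau> i" i] by (metis less_irrefl linorder_neqE)
  then show ?thesis using inj by (auto dest: injD)
qed

lemma permute_coords_transpose:
  fixes x :: "real ^ 'd::finite"
  shows "permute_coords (Transposition.transpose i j) x = x + (x $ j - x $ i) *\<^sub>R (axis i 1 - axis j 1)"
  by (auto simp: permute_coords_def vec_eq_iff axis_def Transposition.transpose_def)

text \<open>A maximiser over all permutations cannot reverse any pair, hence preserves the order and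
  fixes \<open>x\<close>; so nothing else attains the maximum.\<close>

lemma rearrangement_strict:
  fixes x w :: "real ^ 'd::finite"
  assumes inj: "inj (\<lambda>i. x $ i)" and mono: "\<And>i j. x $ i < x $ j \<Longrightarrow> w $ i < w $ j"
    and \<sigma>: "\<sigma> permutes UNIV" "permute_coords \<sigma> x \<noteq> x"
  shows "w \<bullet> permute_coords \<sigma> x < w \<bullet> x"
proof -
  let ?f = "\<lambda>\<sigma>. w \<bullet> permute_coords \<sigma> x"
  let ?P = "{\<sigma> :: 'd \<Rightarrow> 'd. \<sigma> permutes UNIV}"
  have triv: "permute_coords \<tau> x = x" if \<tau>: "\<tau> permutes UNIV" and max: "\<And>\<rho>. \<rho> permutes UNIV \<Longrightarrow> ?f \<rho> \<le> ?f \<tau>" for \<tau>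
  proof -
    have "x $ \<tau> i < x $ \<tau> j" if "x $ i < x $ j" for i j
    proof (rule ccontr)
      assume n: "\<not> x $ \<tau> i < x $ \<tau> j"
      have wij: "w $ i < w $ j" using mono[OF that] .
      have "\<tau> i \<noteq> \<tau> j" using that permutes_inj[OF \<tau>] by (auto dest: injD)
      then have "x $ \<tau> j < x $ \<tau> i" using n inj by (auto simp: not_less le_less dest: injD)
      then have pos: "0 < (x $ \<tau> j - x $ \<tau> i) * (w $ i - w $ j)"
        using wij by (simp add: mult_neg_neg)
      let ?\<rho> = "\<tau> \<circ> Transposition.transpose i j"
      \<comment> \<open>The swap changes the value by a product of two negative factors, against
        maximality.\<close>
      have "?f ?\<rho> = ?f \<tau> + (x $ \<tau> j - x $ \<tau> i) * (w $ i - w $ j)"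
        unfolding permute_coords_permute_coords[symmetric] permute_coords_transpose
        by (simp add: permute_coords_def inner_add_right inner_diff_right inner_axis)
      moreover have "?\<rho> permutes UNIV"
        by (rule permutes_compose[OF _ \<tau>]) (simp add: permutes_swap_id)
      ultimately show False using max[of ?\<rho>] pos by simp
    qed
    then have "\<tau> i = i" for i
      using order_automorphism_trivial[OF inj permutes_bij[OF \<tau>]] by blast
    then show ?thesis by (simp add: permute_coords_def)
  qed
  have fin: "finite (?f ` ?P)" "?f ` ?P \<noteq> {}"
    by (auto simp: finite_permutations intro: permutes_id)
  obtain \<tau> where \<tau>: "\<tau> permutes UNIV" "Max (?f ` ?P) = ?f \<tau>" using Max_in[OF fin] by blast
  have max: "?f \<rho> \<le> ?f \<tau>" if "\<rho> permutes UNIV" for \<rho>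
    unfolding \<tau>(2)[symmetric] by (rule Max_ge[OF fin(1)]) (use that in blast)
  have x: "?f \<tau> = w \<bullet> x" using triv[OF \<tau>(1) max] by simp
  have "?f \<sigma> \<noteq> ?f \<tau>"
    using triv[OF \<sigma>(1)] max \<sigma>(2) by metis
  then show ?thesis using max[OF \<sigma>(1)] x by simp
qed

text \<open>Chebyshev's sum identity expresses \<open>w \<bullet> x\<close> through nonnegative pair
  products \<open>?D\<close> and the product of the two sums. If the entries of \<open>x\<close> sum
  to 0, then \<open>x\<close> is not constant and \<open>?D\<close> is positive.\<close>

lemma inner_pos_of_same_order:
  fixes x w :: "real ^ 'd::finite"
  assumes x: "x \<noteq> 0" and mono: "\<And>i j. x $ i < x $ j \<Longrightarrow> w $ i < w $ j"
    and pos: "(\<Sum>i\<in>UNIV. x $ i) \<noteq> 0 \<Longrightarrow> 0 < (\<Sum>i\<in>UNIV. x $ i) * (\<Sum>i\<in>UNIV. w $ i)"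
  shows "0 < w \<bullet> x"
proof -
  let ?D = "\<Sum>i\<in>UNIV. \<Sum>j\<in>UNIV. (w $ i - w $ j) * (x $ i - x $ j)"
  let ?sx = "\<Sum>i\<in>UNIV. x $ i" and ?sw = "\<Sum>i\<in>UNIV. w $ i"
  have nonneg: "0 \<le> (w $ i - w $ j) * (x $ i - x $ j)" for i j
    using mono[of i j] mono[of j i] by (cases "x $ i" "x $ j" rule: linorder_cases)
      (auto intro: mult_nonpos_nonpos)
  have "?D = (\<Sum>i\<in>UNIV. \<Sum>j\<in>UNIV. w $ i * x $ i + w $ j * x $ j - w $ i * x $ j - w $ j * x $ i)"
    by (intro sum.cong refl) (simp add: algebra_simps)
  also have "\<dots> = 2 * real CARD('d) * (w \<bullet> x) - 2 * (?sx * ?sw)"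
    by (simp add: sum.distrib sum_subtractf inner_vec_def flip: sum_distrib_left sum_distrib_right)
  finally have D: "?D = 2 * real CARD('d) * (w \<bullet> x) - 2 * (?sx * ?sw)" .
  have "0 < 2 * real CARD('d) * (w \<bullet> x)"
  proof (cases "?sx = 0")
    case False
    have "0 \<le> ?D" using nonneg by (intro sum_nonneg)
    then show ?thesis using pos[OF False] D by linarith
  next
    case True
    obtain i where i: "x $ i \<noteq> 0" using x by (auto simp: vec_eq_iff)
    obtain j where j: "x $ i \<noteq> x $ j"
    proof (rule ccontr)
      assume "\<not> thesis"
      then have "x $ j = x $ i" for j using that by metis
      then have "?sx = (\<Sum>j\<in>(UNIV :: 'd set). x $ i)" by (intro sum.cong refl)
      then show False using i True by simp
    qed
    have "(w $ i - w $ j) * (x $ i - x $ j) \<noteq> 0"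
      using j mono[of i j] mono[of j i] by (auto simp: neq_iff)
    then have "0 < (w $ i - w $ j) * (x $ i - x $ j)" using nonneg[of i j] by (metis order_less_le)
    then have "0 < (\<Sum>j\<in>UNIV. (w $ i - w $ j) * (x $ i - x $ j))"
      by (rule sum_pos2[OF finite UNIV_I]) (rule nonneg)
    then have "0 < ?D" by (rule sum_pos2[OF finite UNIV_I]) (intro sum_nonneg nonneg)
    then show ?thesis using True D by simp
  qed
  then show ?thesis by (simp add: zero_less_mult_iff)
qed

lemma matrix_axis_inner:
  fixes A :: "real ^ 'd::finite ^ 'm::finite"
  shows "(c v* A) $ i = (A *v axis i 1) \<bullet> c"
proof -
  have "(c v* A) $ i = (c v* A) \<bullet> axis i 1" by (simp add: inner_axis)
  also have "\<dots> = (A *v axis i 1) \<bullet> c" unfolding dot_lmul_matrix by (rule inner_commute)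
  finally show ?thesis .
qed

lemma sum_vector_matrix_mult:
  fixes A :: "real ^ 'd::finite ^ 'm::finite"
  shows "(\<Sum>i\<in>UNIV. (c v* A) $ i) = (A *v 1) \<bullet> c"
proof -
  have "(\<Sum>i\<in>UNIV. (c v* A) $ i) = (c v* A) \<bullet> 1" by (simp add: inner_vec_def)
  also have "\<dots> = (A *v 1) \<bullet> c" unfolding dot_lmul_matrix by (rule inner_commute)
  finally show ?thesis .
qed

text \<open>Testing the certificate against the transposition of \<open>i\<close> and
  \<open>j\<close> compares its two entries.\<close>

lemma program_succeeds_imp_order:
  fixes A :: "(real, 'd::{finite,linorder}) vec ^ 'm"
  assumes x: "x \<noteq> 0" and S: "program_succeeds x A"
  shows "\<exists>c. \<forall>i j. x $ i < x $ j \<longrightarrow> (A *v axis i 1) \<bullet> c < (A *v axis j 1) \<bullet> c"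
proof -
  obtain c where c: "\<And>\<sigma>. \<sigma> permutes UNIV \<Longrightarrow> permute_coords \<sigma> x \<noteq> x \<Longrightarrow>
      (c v* A) \<bullet> permute_coords \<sigma> x < (c v* A) \<bullet> x"
    using S unfolding program_succeeds_iff_separating[OF x] dot_lmul_matrix by blast
  have "(c v* A) $ i < (c v* A) $ j" if ij: "x $ i < x $ j" for i j
  proof -
    let ?t = "Transposition.transpose i j"
    have "permute_coords ?t x $ i \<noteq> x $ i" using ij by (simp add: permute_coords_def)
    then have "permute_coords ?t x \<noteq> x" by auto
    then have "(c v* A) \<bullet> permute_coords ?t x < (c v* A) \<bullet> x"
      by (intro c) (simp_all add: permutes_swap_id)
    then have "(x $ j - x $ i) * ((c v* A) $ i - (c v* A) $ j) < 0"
      by (simp add: permute_coords_transpose inner_add_right inner_diff_right inner_axis)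
    then show ?thesis using ij by (simp add: mult_less_0_iff)
  qed
  then show ?thesis unfolding matrix_axis_inner by blast
qed

text \<open>The rearrangement inequality separates the permutations, Chebyshev's inequality the
  point 0.\<close>

lemma program_succeeds_if_order:
  fixes A :: "(real, 'd::{finite,linorder}) vec ^ 'm"
  assumes x: "x \<noteq> 0" "inj (\<lambda>i. x $ i)"
    and mono: "\<And>i j. x $ i < x $ j \<Longrightarrow> (A *v axis i 1) \<bullet> c < (A *v axis j 1) \<bullet> c"
    and pos: "(\<Sum>i\<in>UNIV. x $ i) \<noteq> 0 \<Longrightarrow> 0 < (\<Sum>i\<in>UNIV. x $ i) * ((A *v 1) \<bullet> c)"
  shows "program_succeeds x A"
  unfolding program_succeeds_iff_separating[OF x(1)] dot_lmul_matrix[symmetric]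
proof (intro exI[of _ c] conjI allI impI)
  have mono': "(c v* A) $ i < (c v* A) $ j" if "x $ i < x $ j" for i j
    unfolding matrix_axis_inner using mono[OF that] .
  show "0 < (c v* A) \<bullet> x"
    by (rule inner_pos_of_same_order[OF x(1) mono']) (use pos in \<open>simp_all add: sum_vector_matrix_mult\<close>)
  show "(c v* A) \<bullet> permute_coords \<sigma> x < (c v* A) \<bullet> x"
    if "\<sigma> permutes UNIV" "permute_coords \<sigma> x \<noteq> x" for \<sigma>
    by (rule rearrangement_strict[OF x(2) mono' that])
qed

lemma continuous_matrix_vector_inner:
  "continuous_on UNIV (\<lambda>G :: real ^ 'd::finite ^ 'm::finite. (G *v v) \<bullet> c)"
proof -
  have "linear (\<lambda>G :: real ^ 'd ^ 'm. (G *v v) \<bullet> c)"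
    by (rule linearI) (simp_all add: matrix_vector_mult_add_rdistrib inner_add_left scaleR_matrix_vector_assoc[symmetric])
  then show ?thesis by (intro linear_continuous_on) (simp add: linear_conv_bounded_linear)
qed

text \<open>For each fixed certificate, finitely many strict inequalities are continuous in
  \<open>A\<close>. Openness serves to make success measurable.\<close>

lemma open_program_succeeds:
  fixes x :: "(real, 'd::{finite,linorder}) vec"
  assumes "x \<noteq> 0"
  shows "open {A :: (real, 'd) vec ^ 'm. program_succeeds x A}"
proof -
  let ?Q = "{p. (\<exists>\<sigma>. \<sigma> permutes UNIV \<and> p = permute_coords \<sigma> x) \<and> p \<noteq> x}"
  have fin: "finite ?Q" by (rule finite_subset[OF _ finite_permute_coords[of x]]) auto
  have "{A :: (real, 'd) vec ^ 'm. program_succeeds x A} =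
    (\<Union>c. {A. 0 < (A *v x) \<bullet> c} \<inter> (\<Inter>p\<in>?Q. {A. (A *v p) \<bullet> c < (A *v x) \<bullet> c}))"
    unfolding program_succeeds_iff_separating[OF assms] by (auto simp: inner_commute)
  also have "open \<dots>"
    by (intro open_UN open_Int open_INT fin ballI open_Collect_less continuous_matrix_vector_inner
        continuous_on_const)
  finally show ?thesis .
qed

lemma program_succeeds_zero:
  fixes A :: "(real, 'd::{finite,linorder}) vec ^ 'm"
  shows "program_succeeds 0 A"
  unfolding program_succeeds_iff
proof (intro ballI impI)
  fix z :: "(real, 'd) vec" assume "z \<in> zero_permutahedron 0"
  then obtain v b where "b \<in> permutahedron (0 :: (real, 'd) vec)" "z = v *\<^sub>R b"
    using zero_permutahedronE by blast
  then show "z = 0" using norm_permutahedron_le[of b 0] by simp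
qed

section \<open>Exchangeability of the columns\<close>

text \<open>The value \<open>(G *v 1) \<bullet> c\<close> is the sum of the entries of
  \<open>c v* G\<close>. Taking \<open>UNIV\<close> for \<open>U\<close> serves the upper bound, a
  half-line the lower one.\<close>

definition order_event :: "real set \<Rightarrow> 'd list \<Rightarrow> (real ^ 'd::finite ^ 'm::finite) set" where
  "order_event U xs = {G. \<exists>c. sorted_wrt (\<lambda>i j. (G *v axis i 1) \<bullet> c < (G *v axis j 1) \<bullet> c) xs \<and>
     (G *v 1) \<bullet> c \<in> U}"

lemma open_order_event:
  assumes "open U"
  shows "open (order_event U xs :: (real ^ 'd::finite ^ 'm::finite) set)"
proof -
  let ?I = "{(r, s). r < s \<and> s < length xs}"
  have fin: "finite ?I" by (rule finite_subset[of _ "{..<length xs} \<times> {..<length xs}"]) auto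
  have srt: "sorted_wrt (\<lambda>i j. (G *v axis i 1) \<bullet> c < (G *v axis j 1) \<bullet> c) xs \<longleftrightarrow>
      (\<forall>p\<in>?I. (G *v axis (xs ! fst p) 1) \<bullet> c < (G *v axis (xs ! snd p) 1) \<bullet> c)"
    for G :: "real ^ 'd ^ 'm" and c
    by (auto simp: sorted_wrt_iff_nth_less)
  have "(order_event U xs :: (real ^ 'd ^ 'm) set) = (\<Union>c.
      (\<Inter>p\<in>?I. {G. (G *v axis (xs ! fst p) 1) \<bullet> c < (G *v axis (xs ! snd p) 1) \<bullet> c}) \<inter>
      (\<lambda>G. (G *v 1) \<bullet> c) -` U)"
    unfolding order_event_def srt by blast
  also have "open \<dots>"
    by (intro open_UN open_Int open_INT fin ballI open_Collect_less continuous_matrix_vector_inner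
        open_vimage[OF assms])
  finally show ?thesis .
qed

definition permute_columns :: "('d \<Rightarrow> 'd) \<Rightarrow> real ^ 'd ^ 'm \<Rightarrow> real ^ 'd ^ 'm" where
  "permute_columns \<tau> G = (\<chi> i j. G $ i $ \<tau> j)"

text \<open>The sum of the columns is invariant, so the constraint by \<open>U\<close> respects the
  symmetry.\<close>

lemma permute_columns_order_event:
  fixes G :: "real ^ 'd::finite ^ 'm::finite"
  assumes "\<tau> permutes UNIV"
  shows "permute_columns \<tau> G \<in> order_event U xs \<longleftrightarrow> G \<in> order_event U (map \<tau> xs)"
proof -
  have "permute_columns \<tau> G *v axis j 1 = G *v axis (\<tau> j) 1" for j
    by (simp add: matrix_vector_mult_basis column_def permute_columns_def)
  moreover have "permute_columns \<tau> G *v 1 = G *v 1"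
    using sum.permute[OF assms, of "\<lambda>j. G $ i $ j" for i]
    by (simp add: matrix_vector_mult_def permute_columns_def o_def)
  ultimately show ?thesis by (simp add: order_event_def sorted_wrt_map)
qed

lemma distr_gaussian_permute_columns:
  assumes "\<tau> permutes (UNIV :: 'd set)"
  shows "distr (gaussian (UNIV :: ('m \<times> 'd) set)) (gaussian UNIV) (\<lambda>f p. f (fst p, \<tau> (snd p))) = gaussian UNIV"
proof -
  let ?t = "\<lambda>p :: 'm \<times> 'd. (fst p, \<tau> (snd p))"
  have "inj ?t" using permutes_inj[OF assms] by (auto simp: inj_on_def)
  then have "distr (PiM UNIV (\<lambda>_. std_normal)) (PiM UNIV (\<lambda>_. std_normal)) (\<lambda>f. \<lambda>p\<in>UNIV. f (?t p)) =
      PiM UNIV (\<lambda>_. std_normal)"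
    using distr_PiM_reindex[of UNIV "\<lambda>_. std_normal" ?t UNIV] prob_space_std_normal by simp
  then show ?thesis by (simp add: gaussian_def restrict_def)
qed

section \<open>The probability of an ordering as a normalised expected count\<close>

text \<open>The type argument fixes the number of rows, which the list does not determine.\<close>

definition order_prob :: "'m::finite itself \<Rightarrow> real set \<Rightarrow> 'd::finite list \<Rightarrow> real" where
  "order_prob _ U xs = measure (gaussian (UNIV :: ('m \<times> 'd) set))
     {f. (matrix_of UNIV f :: real ^ 'd ^ 'm) \<in> order_event U xs}"

lemma order_prob_map:
  assumes \<tau>: "\<tau> permutes (UNIV :: 'd::finite set)" and U: "open U"
  shows "order_prob TYPE('m::finite) U (map \<tau> xs) = order_prob TYPE('m) U xs"
proof -
  let ?M = "gaussian (UNIV :: ('m \<times> 'd) set)"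
  let ?E = "\<lambda>xs. {f. (matrix_of UNIV f :: real ^ 'd ^ 'm) \<in> order_event U xs}"
  let ?T = "\<lambda>f p. f (fst p, \<tau> (snd p)) :: real"
  have sp: "space ?M = UNIV" by (simp add: space_gaussian)
  have meas: "?E xs \<in> sets ?M" for xs
    using measurable_sets[OF measurable_matrix_of[of "UNIV :: 'm set"], of "order_event U xs"]
      borel_open[OF open_order_event[OF U, of xs, where 'm = 'm]] sp
    by (simp add: vimage_def)
  have T: "?T \<in> measurable ?M ?M"
  proof -
    have "(\<lambda>f. \<lambda>p\<in>UNIV. ?T f p) \<in> measurable ?M (PiM UNIV (\<lambda>_. std_normal))"
      by (rule measurable_restrict) (simp add: gaussian_def)
    then show ?thesis by (simp add: gaussian_def restrict_def)
  qed
  have "?T -` ?E xs \<inter> space ?M = ?E (map \<tau> xs)"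
  proof -
    have "matrix_of UNIV (?T f) = permute_columns \<tau> (matrix_of UNIV f :: real ^ 'd ^ 'm)" for f
      by (simp add: matrix_of_def permute_columns_def)
    then show ?thesis by (auto simp: sp permute_columns_order_event[OF \<tau>])
  qed
  then have "measure ?M (?E (map \<tau> xs)) = measure (distr ?M ?M ?T) (?E xs)"
    using measure_distr[OF T meas] by simp
  then show ?thesis unfolding order_prob_def distr_gaussian_permute_columns[OF \<tau>] .
qed

lemma list_permutation_exists:
  fixes xs ys :: "'d::finite list"
  assumes "distinct xs" "set xs = UNIV" "distinct ys" "set ys = UNIV"
  obtains \<tau> where "\<tau> permutes UNIV" "map \<tau> xs = ys"
proof -
  have len: "length xs = length ys" using assms by (metis distinct_card)
  let ?t = "\<lambda>i. the (map_of (zip xs ys) i)"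
  have map: "map ?t xs = ys"
    by (rule nth_equalityI) (use len assms in \<open>auto simp: map_of_zip_nth\<close>)
  then have "?t ` UNIV = UNIV" using assms by (metis image_set)
  then have "bij ?t" by (simp add: bij_def finite_UNIV_surj_inj)
  then show ?thesis using map by (intro that[of ?t]) (simp add: permutes_def bij_iff)
qed

lemma order_prob_eq:
  fixes xs ys :: "'d::finite list"
  assumes "distinct xs" "set xs = UNIV" "distinct ys" "set ys = UNIV" "open U"
  shows "order_prob TYPE('m::finite) U ys = order_prob TYPE('m) U xs"
proof -
  obtain \<tau> where "\<tau> permutes UNIV" "map \<tau> xs = ys"
    using list_permutation_exists[OF assms(1-4)] .
  then show ?thesis using order_prob_map[OF _ assms(5), of \<tau> xs] by blast
qed

text \<open>By exchangeability all orderings are equally likely; linearity of expectation then sums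
  their probabilities to the mean count.\<close>

lemma fact_order_prob_eq_expectation:
  fixes xs :: "'d::finite list"
  assumes xs: "distinct xs" "set xs = UNIV" and U: "open U"
  defines "N \<equiv> \<lambda>f. card {ys \<in> permutations_of_set UNIV. (matrix_of UNIV f :: real ^ 'd ^ 'm::finite) \<in> order_event U ys}"
  shows "fact CARD('d) * order_prob TYPE('m) U xs = (\<integral>f. real (N f) \<partial>gaussian UNIV)"
    and "integrable (gaussian UNIV) (\<lambda>f. real (N f))"
proof -
  let ?M = "gaussian (UNIV :: ('m \<times> 'd) set)"
  let ?E = "\<lambda>ys. {f. (matrix_of UNIV f :: real ^ 'd ^ 'm) \<in> order_event U ys}"
  let ?P = "permutations_of_set (UNIV :: 'd set)"
  interpret prob_space ?M by (rule prob_space_gaussian)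
  have sp: "space ?M = UNIV" by (simp add: space_gaussian)
  have meas: "?E ys \<in> sets ?M" for ys
    using measurable_sets[OF measurable_matrix_of[of "UNIV :: 'm set"], of "order_event U ys"]
      borel_open[OF open_order_event[OF U, of ys, where 'm = 'm]] sp
    by (simp add: vimage_def)
  have N: "real (N f) = (\<Sum>ys\<in>?P. indicator (?E ys) f)" for f
    unfolding N_def by (simp add: indicator_def sum.If_cases Int_def)
  have int: "integrable ?M (indicator (?E ys) :: _ \<Rightarrow> real)" for ys
    using meas by (simp add: integrable_indicator_iff emeasure_finite less_top[symmetric])
  then show "integrable ?M (\<lambda>f. real (N f))" unfolding N by (intro Bochner_Integration.integrable_sum)
  have "(\<integral>f. real (N f) \<partial>?M) = (\<Sum>ys\<in>?P. measure ?M (?E ys))"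
    unfolding N using int meas by (subst Bochner_Integration.integral_sum) (simp_all add: sp)
  also have "\<dots> = (\<Sum>ys\<in>?P. order_prob TYPE('m) U xs)"
  proof (intro sum.cong refl)
    fix ys assume "ys \<in> ?P"
    then have "distinct ys" "set ys = UNIV" by (auto simp: permutations_of_set_def)
    then show "measure ?M (?E ys) = order_prob TYPE('m) U xs"
      using order_prob_eq[OF xs _ _ U, where 'm = 'm] by (simp add: order_prob_def)
  qed
  also have "\<dots> = fact CARD('d) * order_prob TYPE('m) U xs"
    by simp
  finally show "fact CARD('d) * order_prob TYPE('m) U xs = (\<integral>f. real (N f) \<partial>?M)" ..
qed

lemma order_prob_le:
  fixes xs :: "'d::finite list"
  assumes xs: "distinct xs" "set xs = UNIV"
  shows "fact CARD('d) * order_prob TYPE('m::finite) UNIV xs \<le> order_count (CARD('d) - 1) CARD('m)"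
proof -
  interpret prob_space "gaussian (UNIV :: ('m \<times> 'd) set)" by (rule prob_space_gaussian)
  have "card {ys \<in> permutations_of_set UNIV. G \<in> order_event UNIV ys} \<le> order_count (CARD('d) - 1) CARD('m)"
    for G :: "real ^ 'd ^ 'm"
  proof -
    have "{ys \<in> permutations_of_set UNIV. G \<in> order_event UNIV ys} = orders (\<lambda>i. G *v axis i 1) UNIV UNIV"
      using orders_subset_permutations[of "\<lambda>i. G *v axis i 1" UNIV UNIV]
      by (auto simp: orders_def order_event_def permutations_of_set_def)
    then show ?thesis using card_orders_le[of UNIV UNIV "\<lambda>i. G *v axis i 1"] by (simp add: dim_UNIV)
  qed
  then show ?thesis
    unfolding fact_order_prob_eq_expectation(1)[OF xs open_UNIV]
    by (intro integral_le_const fact_order_prob_eq_expectation(2)[OF xs open_UNIV]) auto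
qed

text \<open>Only finitely many sets \<open>C\<close> occur, so injectivity on each span holds
  simultaneously. This supplies the genericity assumption of \<open>card_orders_ge\<close>.\<close>

lemma AE_gaussian_generic:
  fixes F :: "(real ^ 'd::finite) set"
  assumes "finite F"
  shows "AE f in gaussian (UNIV :: ('m::finite \<times> 'd) set). \<forall>C\<subseteq>F. card C \<le> CARD('m) \<longrightarrow>
    (\<forall>b\<in>span C. (matrix_of UNIV f :: real ^ 'd ^ 'm) *v b = 0 \<longrightarrow> b = 0)"
proof -
  have "AE f in gaussian (UNIV :: ('m \<times> 'd) set). \<forall>C\<in>{C. C \<subseteq> F \<and> card C \<le> CARD('m)}.
    (\<forall>b\<in>span C. (matrix_of UNIV f :: real ^ 'd ^ 'm) *v b = 0 \<longrightarrow> b = 0)"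
  proof (rule AE_finite_allI)
    show "finite {C. C \<subseteq> F \<and> card C \<le> CARD('m)}"
      by (rule finite_subset[of _ "Pow F"]) (use assms in auto)
    fix C assume C: "C \<in> {C. C \<subseteq> F \<and> card C \<le> CARD('m)}"
    have "dim (span C) \<le> card C"
      using C assms finite_subset[of C F] by (auto intro: dim_le_card')
    then have "dim (span C) \<le> card (UNIV :: 'm set)" using C by simp
    from AE_gaussian_injective_on[OF subspace_span this]
    show "AE f in gaussian (UNIV :: ('m \<times> 'd) set).
      \<forall>b\<in>span C. (matrix_of UNIV f :: real ^ 'd ^ 'm) *v b = 0 \<longrightarrow> b = 0"
      unfolding UNIV_Times_UNIV .
  qed
  then show ?thesis by eventually_elim blast
qed

text \<open>
  The constraint \<open>0 < t * r\<close> is met by perturbing functionals that are orthogonal to \<open>G *v 1\<close>, which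
  is why the dimension drops to \<open>m - 1\<close>.
\<close>

lemma order_prob_ge:
  fixes xs :: "'d::finite list" and t :: real
  assumes xs: "distinct xs" "set xs = UNIV" and t: "t \<noteq> 0"
  shows "order_count (CARD('d) - 1) (CARD('m) - 1) \<le>
    fact CARD('d) * order_prob TYPE('m::finite) {r. 0 < t * r} xs"
proof -
  interpret prob_space "gaussian (UNIV :: ('m \<times> 'd) set)" by (rule prob_space_gaussian)
  let ?U = "{r. 0 < t * r}"
  let ?F = "insert 1 (range (\<lambda>(i, j). axis i 1 - axis j 1)) :: (real ^ 'd) set"
  have fin: "finite ?F" by simp
  have U: "open ?U" by (intro open_Collect_less continuous_intros)
  have "AE f in gaussian (UNIV :: ('m \<times> 'd) set). order_count (CARD('d) - 1) (CARD('m) - 1) \<le>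
      card {ys \<in> permutations_of_set UNIV. (matrix_of UNIV f :: real ^ 'd ^ 'm) \<in> order_event ?U ys}"
    using AE_gaussian_generic[OF fin, where 'm = 'm]
  proof eventually_elim
    case (elim f)
    let ?G = "matrix_of UNIV f :: real ^ 'd ^ 'm"
    have gen: "b = 0" if "C \<subseteq> ?F" "card C \<le> CARD('m)" "b \<in> span C" "?G *v b = 0" for C b
      using elim that by blast
    let ?V = "{c. \<forall>b\<in>{1}. (?G *v b) \<bullet> c = 0}"
    have "order_count (card (UNIV :: 'd set) - 1) (CARD('m) - 1) \<le> card (orders (\<lambda>j. ?G *v axis j 1) UNIV ?V)"
    proof (rule card_orders_ge[where F = ?F and m = "CARD('m)"])
      show "card {1 :: real ^ 'd} + (CARD('m) - 1) \<le> CARD('m)" using zero_less_card_finite[where 'a = 'm] by simp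
      fix b :: "real ^ 'd" assume b: "b \<in> span {1}" "(\<Sum>j\<in>UNIV. b $ j) = 0"
      then show "b = 0" by (auto simp: span_singleton)
    qed (use gen in auto)
    also have "orders (\<lambda>j. ?G *v axis j 1) UNIV ?V \<subseteq> {ys \<in> permutations_of_set UNIV. ?G \<in> order_event ?U ys}"
    proof
      fix ys assume ys: "ys \<in> orders (\<lambda>j. ?G *v axis j 1) UNIV ?V"
      then obtain c where c: "(?G *v 1) \<bullet> c = 0"
        "sorted_wrt (\<lambda>i j. (?G *v axis i 1) \<bullet> c < (?G *v axis j 1) \<bullet> c) ys"
        by (auto simp: orders_def)
      \<comment> \<open>Genericity for \<open>{1}\<close> provides the direction in which the sum of
        the entries can be moved off 0.\<close>
      have v: "?G *v 1 \<noteq> 0"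
      proof
        assume "?G *v 1 = 0"
        then have "(1 :: real ^ 'd) = 0"
          by (intro gen[of "{1}"]) (auto simp: span_base Suc_le_eq)
        then show False by simp
      qed
      \<comment> \<open>Scaling by \<open>t\<close> gives the sum the sign of
        \<open>t\<close>.\<close>
      let ?u = "t *\<^sub>R (?G *v 1)"
      have "eventually (\<lambda>e::real. 0 < e) (at_right 0)" by (simp add: eventually_at_right_less)
      then have "eventually (\<lambda>e. 0 < e \<and> sorted_wrt (\<lambda>i j. (?G *v axis i 1) \<bullet> (c + e *\<^sub>R ?u) <
          (?G *v axis j 1) \<bullet> (c + e *\<^sub>R ?u)) ys) (at_right 0)"
        by (intro eventually_conj eventually_sorted_wrt_perturb c(2))
      from eventually_happens'[OF trivial_limit_at_right_real this]
      obtain e where e: "0 < e" "sorted_wrt (\<lambda>i j. (?G *v axis i 1) \<bullet> (c + e *\<^sub>R ?u) <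
          (?G *v axis j 1) \<bullet> (c + e *\<^sub>R ?u)) ys" by blast
      have "t * ((?G *v 1) \<bullet> (c + e *\<^sub>R ?u)) = e * (t * t) * ((?G *v 1) \<bullet> (?G *v 1))"
        using c(1) by (simp add: inner_add_right)
      also have "\<dots> > 0"
      proof (rule mult_pos_pos[OF mult_pos_pos[OF e(1)]])
        show "0 < t * t" using t by (simp flip: power2_eq_square)
        show "0 < (?G *v 1) \<bullet> (?G *v 1)" using v by simp
      qed
      finally show "ys \<in> {ys \<in> permutations_of_set UNIV. ?G \<in> order_event ?U ys}"
        using e(2) ys orders_subset_permutations by (auto simp: order_event_def)
    qed
    then have "card (orders (\<lambda>j. ?G *v axis j 1) UNIV ?V) \<le> card {ys \<in> permutations_of_set UNIV. ?G \<in> order_event ?U ys}"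
      by (intro card_mono) simp_all
    finally show ?case .
  qed
  then show ?thesis
    unfolding fact_order_prob_eq_expectation(1)[OF xs U]
    by (intro integral_ge_const fact_order_prob_eq_expectation(2)[OF xs U]) (auto elim: eventually_mono)
qed

section \<open>Probability of success\<close>

lemma ln_less_harm: "n \<ge> 1 \<Longrightarrow> ln (real n) < harm n"
proof -
  assume n: "n \<ge> 1"
  have "ln (real n) < ln (real n + 1)" using n by simp
  also have "\<dots> \<le> harm n" by (rule ln_le_harm)
  finally show ?thesis .
qed

text \<open>Equality holds for \<open>n = 1\<close>, and each further increment of
  \<open>harm\<close> is strictly smaller than that of the logarithm.\<close>

lemma harm_less_one_plus_ln:
  assumes "n \<ge> 2"
  shows "harm n < 1 + ln (real n)"
proof -
  have step: "1 / real (Suc n) < ln (real (Suc n)) - ln (real n)" if "n \<ge> 1" for n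
  proof -
    let ?q = "real n / real (Suc n)"
    have "0 < ?q" "?q \<noteq> 1" using that by simp_all
    then have "ln ?q < ?q - 1"
      using ln_le_minus_one[of ?q] ln_eq_minus_one[of ?q] by linarith
    moreover have "real n / real (Suc n) - 1 = - (1 / real (Suc n))" by (simp add: field_simps)
    moreover have "ln (real n / real (Suc n)) = ln (real n) - ln (real (Suc n))"
      using that by (simp add: ln_div)
    ultimately show ?thesis by linarith
  qed
  from assms show ?thesis
  proof (induction n rule: dec_induct)
    case base
    then show ?case using step[of 1] by (simp add: harm_expand)
  next
    case (step n)
    then show ?case using \<open>\<And>n. n \<ge> 1 \<Longrightarrow> 1 / real (Suc n) < ln (real (Suc n)) - ln (real n)\<close>[of n]
      by (simp add: harm_Suc inverse_eq_divide)
  qed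
qed

lemma one_minus_exp_neg_ge:
  fixes t :: real
  assumes "0 \<le> t"
  shows "t - t\<^sup>2 / 2 \<le> 1 - exp (- t)"
proof -
  let ?f = "\<lambda>t::real. 1 - exp (- t) - t + t\<^sup>2 / 2"
  have "?f 0 \<le> ?f t"
  proof (rule DERIV_nonneg_imp_nondecreasing[OF assms])
    fix s :: real assume "0 \<le> s" "s \<le> t"
    have "(?f has_real_derivative exp (- s) - 1 + s) (at s)"
      by (auto intro!: derivative_eq_intros)
    moreover have "0 \<le> exp (- s) - 1 + s" using exp_ge_add_one_self[of "- s"] by simp
    ultimately show "\<exists>y. (?f has_real_derivative y) (at s) \<and> 0 \<le> y" by blast
  qed
  then show ?thesis by simp
qed

lemma order_count_tail_upper:
  fixes lam :: real
  assumes d: "d \<ge> 1" and lam: "0 \<le> lam" "lam < sqrt (harm d)"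
    and m: "real m \<le> real d - harm d - lam * sqrt (harm d)"
  shows "real (order_count (d - 1) m) \<le> fact d * (4 * exp (- (lam\<^sup>2 / 16)))"
proof -
  obtain n where n: "d = Suc n" using d by (cases d) auto
  let ?H = "harm d :: real"
  let ?s = "sqrt ?H"
  have H: "1 \<le> ?H" using harm_mono[of 1 d, where 'a = real] d by (simp add: harm_expand)
  have s: "0 < ?s" "?s * ?s = ?H" using H d by simp_all
  \<comment> \<open>Minimises the quadratic \<open>t\<^sup>2 * ?H - t * lam * ?s\<close>, which
    bounds the exponent; \<open>lam < ?s\<close> keeps \<open>t\<close> below 1, where
    \<open>exp t - 1 - t \<le> t\<^sup>2\<close>.\<close>
  define t where "t = lam / (2 * ?s)"
  have t: "0 \<le> t" "t \<le> 1" "lam = 2 * t * ?s"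
    using lam s H by (auto simp: t_def field_simps)
  have "exp t - 1 - t \<le> t\<^sup>2" using exp_bound[OF t(1,2)] by simp
  then have "(exp t - 1 - t) * (?H - 1) \<le> t\<^sup>2 * (?H - 1)" using H by (intro mult_right_mono) auto
  moreover
  have ls: "lam * ?s = 2 * t * ?H" using s(2) by (simp add: t(3) mult.assoc)
  have "t * real m \<le> t * (real d - ?H - 2 * t * ?H)"
    using m[unfolded ls] t(1) by (intro mult_left_mono)
  ultimately have "t * real m - t * real n + (exp t - 1) * (?H - 1) \<le> - (t\<^sup>2 * ?H) - t\<^sup>2"
    by (simp add: n algebra_simps power2_eq_square)
  also have "\<dots> \<le> - (t\<^sup>2 * ?H)" by simp
  also have "t\<^sup>2 * ?H = lam\<^sup>2 / 4"
  proof -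
    have "lam\<^sup>2 = 4 * (t\<^sup>2 * (?s * ?s))" unfolding t(3) by algebra
    then show ?thesis unfolding s(2) by simp
  qed
  also have "- (lam\<^sup>2 / 4) \<le> - (lam\<^sup>2 / 16)" by simp
  finally have "exp (t * real m - t * real n + (exp t - 1) * (?H - 1)) \<le> exp (- (lam\<^sup>2 / 16))"
    by simp
  also have "\<dots> \<le> 4 * exp (- (lam\<^sup>2 / 16))" by simp
  finally have "fact d * exp (t * real m - t * real n + (exp t - 1) * (?H - 1)) \<le> fact d * (4 * exp (- (lam\<^sup>2 / 16)))"
    by (intro mult_left_mono) auto
  from order_trans[OF order_count_upper[OF t(1), of n m, folded n] this] show ?thesis by (simp add: n)
qed

text \<open>Working in dimension \<open>m - 1\<close> leaves an extra term \<open>t\<close> in the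
  exponent. As \<open>t\<close> is at most 1, this costs a factor \<open>exp 1\<close>, which the
  constant 4 absorbs.\<close>

lemma order_count_tail_lower:
  fixes lam :: real
  assumes d: "d \<ge> 1" and "m \<ge> 1" and lam: "0 \<le> lam" "lam < sqrt (harm d)"
    and m: "real m \<ge> real d - harm d + lam * sqrt (harm d)"
  shows "fact d * (1 - 4 * exp (- (lam\<^sup>2 / 16))) \<le> real (order_count (d - 1) (m - 1))"
proof -
  obtain n where n: "d = Suc n" using d by (cases d) auto
  obtain l where l: "m = Suc l" using \<open>m \<ge> 1\<close> by (cases m) auto
  let ?H = "harm d :: real"
  let ?s = "sqrt ?H"
  have H: "1 \<le> ?H" using harm_mono[of 1 d, where 'a = real] d by (simp add: harm_expand)
  have s: "0 < ?s" "?s * ?s = ?H" using H d by simp_all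
  \<comment> \<open>Minimises \<open>t\<^sup>2 * ?H / 2 - t * lam * ?s\<close>.\<close>
  define t where "t = lam / ?s"
  have t: "0 \<le> t" "t \<le> 1" "lam = t * ?s"
    using lam s H by (auto simp: t_def field_simps)
  have "(t - t\<^sup>2 / 2) * (?H - 1) \<le> (1 - exp (- t)) * (?H - 1)"
    using one_minus_exp_neg_ge[OF t(1)] H by (intro mult_right_mono) auto
  moreover
  have ls: "lam * ?s = t * ?H" using s(2) by (simp add: t(3) mult.assoc)
  have "t * (real d - ?H + t * ?H) \<le> t * real m"
    using m[unfolded ls] t(1) by (intro mult_left_mono)
  ultimately have "t * real n - t * real l - (1 - exp (- t)) * (?H - 1) \<le> t - t\<^sup>2 * ?H / 2 - t\<^sup>2 / 2"
    by (simp add: n l field_simps power2_eq_square)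
  also have "\<dots> \<le> t - t\<^sup>2 * ?H / 2" by simp
  also have "t\<^sup>2 * ?H = lam\<^sup>2"
  proof -
    have "lam\<^sup>2 = t\<^sup>2 * (?s * ?s)" unfolding t(3) by algebra
    then show ?thesis unfolding s(2) by simp
  qed
  also have "t - lam\<^sup>2 / 2 \<le> 1 + - (lam\<^sup>2 / 16)" using t(2) zero_le_power2[of lam] by linarith
  finally have "exp (t * real n - t * real l - (1 - exp (- t)) * (?H - 1)) \<le> exp (1 + - (lam\<^sup>2 / 16))"
    by simp
  also have "\<dots> = exp 1 * exp (- (lam\<^sup>2 / 16))" by (rule exp_add)
  also have "\<dots> \<le> 4 * exp (- (lam\<^sup>2 / 16))" using exp_le by (intro mult_right_mono) auto
  finally have "fact d * exp (t * real n - t * real l - (1 - exp (- t)) * (?H - 1)) \<le> fact d * (4 * exp (- (lam\<^sup>2 / 16)))"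
    by (intro mult_left_mono) auto
  from order_trans[OF order_count_lower[OF t(1), of n l, folded n] this]
  show ?thesis by (simp add: n l right_diff_distrib)
qed

section \<open>Transfer to the given probability space and conclusion\<close>

text \<open>Independent standard normal entries have the product law, so events about
  \<open>A\<close> can be computed on the canonical space.\<close>

lemma measure_std_normal_matrix:
  fixes A :: "'w \<Rightarrow> real ^ 'd::finite ^ 'm::finite"
  assumes "prob_space M" "std_normal_matrix M A"
  shows "A \<in> borel_measurable M"
    and "B \<in> sets borel \<Longrightarrow> measure M {\<omega> \<in> space M. A \<omega> \<in> B} =
      measure (gaussian (UNIV :: ('m \<times> 'd) set)) {f. matrix_of UNIV f \<in> B}"
proof -
  interpret prob_space M by fact
  let ?X = "\<lambda>(i, j) \<omega>. A \<omega> $ i $ j"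
  let ?F = "\<lambda>\<omega>. \<lambda>p\<in>UNIV. ?X p \<omega>"
  have rv: "?X p \<in> borel_measurable M" and dist: "distr M borel (?X p) = std_normal" for p
  proof -
    have D: "distributed M lborel (?X p) std_normal_density"
      using assms(2) by (cases p) (auto simp: std_normal_matrix_def)
    then show "?X p \<in> borel_measurable M" by (simp add: distributed_def)
    have "distr M borel (?X p) = distr M lborel (?X p)" by (rule distr_cong) simp_all
    then show "distr M borel (?X p) = std_normal" using D by (simp add: distributed_def std_normal_def)
  qed
  show meas: "A \<in> borel_measurable M"
    using rv[of "(i, j)" for i j] by (intro measurable_matrixI) simp
  assume B: "B \<in> sets borel"
  have "distr M (PiM UNIV (\<lambda>_. borel)) ?F = PiM UNIV (\<lambda>p. distr M borel (?X p))"
    using assms(2) rv by (subst indep_vars_iff_distr_eq_PiM[symmetric]) (simp_all add: std_normal_matrix_def)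
  then have G: "distr M (gaussian UNIV) ?F = gaussian UNIV"
    unfolding dist gaussian_def[symmetric]
    by (subst (asm) distr_cong[of M M _ "gaussian UNIV" ?F ?F]) (auto simp: gaussian_def intro!: sets_PiM_cong)
  have F: "?F \<in> measurable M (gaussian UNIV)"
    unfolding gaussian_def using rv by (intro measurable_restrict) (simp add: measurable_cong_sets[OF refl sets_std_normal])
  let ?E = "{f. (matrix_of UNIV f :: real ^ 'd ^ 'm) \<in> B}"
  have "?E \<in> sets (gaussian UNIV)"
    using measurable_sets[OF measurable_matrix_of[of "UNIV :: 'm set"] B]
    by (simp add: vimage_def space_gaussian)
  then have "measure (distr M (gaussian UNIV) ?F) ?E = measure M (?F -` ?E \<inter> space M)"
    by (rule measure_distr[OF F])
  also have "?F -` ?E \<inter> space M = {\<omega> \<in> space M. A \<omega> \<in> B}"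
  proof -
    have "matrix_of UNIV (?F \<omega>) = A \<omega>" for \<omega> by (simp add: matrix_of_def vec_eq_iff)
    then show ?thesis by auto
  qed
  finally show "measure M {\<omega> \<in> space M. A \<omega> \<in> B} = measure (gaussian UNIV) ?E" unfolding G ..
qed

lemma sorted_list_by_vector:
  fixes x :: "real ^ 'd::finite"
  assumes inj: "inj (\<lambda>i. x $ i)"
  obtains xs where "distinct xs" "set xs = UNIV" "sorted_wrt (\<lambda>i j. x $ i < x $ j) xs"
proof -
  obtain ys :: "'d list" where ys: "set ys = UNIV" "distinct ys" using finite_distinct_list[OF finite] by blast
  let ?xs = "sort_key (\<lambda>i. x $ i) ys"
  have "distinct (map (\<lambda>i. x $ i) ?xs)"
    using ys inj by (simp add: distinct_map inj_on_def inj_def)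
  then have "sorted_wrt (<) (map (\<lambda>i. x $ i) ?xs)" by (simp add: strict_sorted_iff)
  then show ?thesis using ys by (intro that[of ?xs]) (simp_all add: sorted_wrt_map)
qed

lemma sorted_wrt_iff_same_order:
  fixes x :: "real ^ 'd::finite" and w :: "'d \<Rightarrow> real"
  assumes xs: "set xs = UNIV" "sorted_wrt (\<lambda>i j. x $ i < x $ j) xs"
  shows "sorted_wrt (\<lambda>i j. w i < w j) xs \<longleftrightarrow> (\<forall>i j. x $ i < x $ j \<longrightarrow> w i < w j)"
proof
  assume w: "sorted_wrt (\<lambda>i j. w i < w j) xs"
  show "\<forall>i j. x $ i < x $ j \<longrightarrow> w i < w j"
  proof (intro allI impI)
    fix i j assume ij: "x $ i < x $ j"
    obtain p q where pq: "p < length xs" "q < length xs" "xs ! p = i" "xs ! q = j"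
      using xs(1) by (metis UNIV_I in_set_conv_nth)
    have "p \<noteq> q" using pq ij by auto
    moreover have "x $ j < x $ i" if "q < p"
      using sorted_wrt_nth_less[OF xs(2) that] pq by simp
    ultimately have "p < q" using ij by (meson less_asym linorder_neqE_nat)
    then show "w i < w j" using w pq by (auto simp: sorted_wrt_iff_nth_less)
  qed
next
  assume "\<forall>i j. x $ i < x $ j \<longrightarrow> w i < w j"
  then show "sorted_wrt (\<lambda>i j. w i < w j) xs"
    by (intro sorted_wrt_mono_rel[OF _ xs(2)]) blast
qed

theorem proposition9p1:
  fixes x\<^sub>0 :: "(real, 'd::{finite,linorder}) vec"
    and M :: "'w measure"
    and A :: "'w \<Rightarrow> (real, 'd) vec ^ 'm"
  assumes "inj (\<lambda>i. x\<^sub>0 $ i)"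
    and "prob_space M"
    and "std_normal_matrix M A"
  defines "d \<equiv> CARD('d)" and "m \<equiv> CARD('m)"
  defines "success \<equiv> {\<omega> \<in> space M. program_succeeds x\<^sub>0 (A \<omega>)}"
  shows "success \<in> sets M \<and>
    (\<forall>lam::real. 0 \<le> lam \<and> lam < sqrt (harm d) \<longrightarrow>
      (real m \<le> real d - harm d - lam * sqrt (harm d) \<longrightarrow>
         measure M success \<le> 4 * exp (- (lam\<^sup>2 / 16))) \<and>
      (real m \<ge> real d - harm d + lam * sqrt (harm d) \<longrightarrow>
         measure M success \<ge> 1 - 4 * exp (- (lam\<^sup>2 / 16)))) \<and>
    ln (real d) < harm d \<and>
    (d \<ge> 2 \<longrightarrow> harm d < 1 + ln (real d))"
proof -
  interpret prob_space M by (rule assms(2))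
  have d: "d \<ge> 1" and m: "m \<ge> 1"
    using zero_less_card_finite[where 'a = 'd] zero_less_card_finite[where 'a = 'm]
    by (simp_all add: d_def m_def Suc_le_eq)
  have harm: "ln (real d) < harm d \<and> (d \<ge> 2 \<longrightarrow> harm d < 1 + ln (real d))"
    using ln_less_harm[OF d] harm_less_one_plus_ln by blast
  show ?thesis
  proof (cases "x\<^sub>0 = 0")
    case True
    then have "success = space M" by (simp add: success_def program_succeeds_zero)
    \<comment> \<open>Distinct entries all equal to 0 leave a single coordinate. The first tail then
      assumes \<open>m\<close> to be at most \<open>- lam\<close>, which is impossible, and success
      is certain.\<close>
    moreover have "d = 1"
    proof (rule ccontr)
      assume "d \<noteq> 1"
      then have "\<not> (\<exists>i. UNIV = {i :: 'd})" by (auto simp: d_def card_1_singleton_iff)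
      then obtain i j :: 'd where "i \<noteq> j" by blast
      then show False using assms(1) True by (auto simp: inj_def)
    qed
    ultimately show ?thesis using harm m by (auto simp: prob_space harm_expand)
  next
    case False
    obtain xs where xs: "distinct xs" "set xs = UNIV" "sorted_wrt (\<lambda>i j. x\<^sub>0 $ i < x\<^sub>0 $ j) xs"
      using sorted_list_by_vector[OF assms(1)] .
    let ?S = "{G :: (real, 'd) vec ^ 'm. program_succeeds x\<^sub>0 G}"
    have S: "?S \<in> sets borel" by (rule borel_open[OF open_program_succeeds[OF False]])
    have meas: "success \<in> sets M"
    proof -
      have "A -` ?S \<inter> space M \<in> sets M"
        by (rule measurable_sets[OF measure_std_normal_matrix(1)[OF assms(2,3)] S])
      then show ?thesis by (simp add: success_def vimage_def Int_def conj_commute)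
    qed
    let ?E = "\<lambda>U. order_event U xs :: ((real, 'd) vec ^ 'm) set"
    have prob: "order_prob TYPE('m) U xs = measure M {\<omega> \<in> space M. A \<omega> \<in> ?E U}"
      and E: "{\<omega> \<in> space M. A \<omega> \<in> ?E U} \<in> sets M" if "open U" for U
    proof -
      have B: "?E U \<in> sets borel" by (rule borel_open[OF open_order_event[OF that]])
      show "order_prob TYPE('m) U xs = measure M {\<omega> \<in> space M. A \<omega> \<in> ?E U}"
        unfolding order_prob_def measure_std_normal_matrix(2)[OF assms(2,3) B] ..
      have "A -` ?E U \<inter> space M \<in> sets M"
        by (rule measurable_sets[OF measure_std_normal_matrix(1)[OF assms(2,3)] B])
      then show "{\<omega> \<in> space M. A \<omega> \<in> ?E U} \<in> sets M" by (simp add: vimage_def Int_def conj_commute)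
    qed
    have upper: "measure M success \<le> order_prob TYPE('m) UNIV xs"
    proof -
      have "?S \<subseteq> ?E UNIV"
        using program_succeeds_imp_order[OF False]
        by (auto simp: order_event_def sorted_wrt_iff_same_order[OF xs(2,3)])
      then have "success \<subseteq> {\<omega> \<in> space M. A \<omega> \<in> ?E UNIV}" by (auto simp: success_def)
      then show ?thesis unfolding prob[OF open_UNIV] by (intro finite_measure_mono E) auto
    qed
    \<comment> \<open>The sign of the sum; if the sum is 0, the condition in
      \<open>program_succeeds_if_order\<close> is void and either sign would do.\<close>
    define t :: real where "t = (if (\<Sum>i\<in>UNIV. x\<^sub>0 $ i) < 0 then -1 else 1)"
    have t: "t \<noteq> 0" by (simp add: t_def)
    let ?U = "{r. 0 < t * r}"
    have U: "open ?U" by (intro open_Collect_less continuous_intros)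
    have lower: "order_prob TYPE('m) ?U xs \<le> measure M success"
    proof -
      have "?E ?U \<subseteq> ?S"
      proof
        fix G assume "G \<in> ?E ?U"
        then obtain c where c: "\<forall>i j. x\<^sub>0 $ i < x\<^sub>0 $ j \<longrightarrow> (G *v axis i 1) \<bullet> c < (G *v axis j 1) \<bullet> c"
          "0 < t * ((G *v 1) \<bullet> c)"
          by (auto simp: order_event_def sorted_wrt_iff_same_order[OF xs(2,3)])
        have "program_succeeds x\<^sub>0 G"
        proof (rule program_succeeds_if_order[OF False assms(1)])
          show "(G *v axis i 1) \<bullet> c < (G *v axis j 1) \<bullet> c" if "x\<^sub>0 $ i < x\<^sub>0 $ j" for i j
            using c(1) that by blast
          show "0 < (\<Sum>i\<in>UNIV. x\<^sub>0 $ i) * ((G *v 1) \<bullet> c)" if "(\<Sum>i\<in>UNIV. x\<^sub>0 $ i) \<noteq> 0"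
            using c(2) that by (auto simp: t_def zero_less_mult_iff split: if_splits)
        qed
        then show "G \<in> ?S" by simp
      qed
      then have "{\<omega> \<in> space M. A \<omega> \<in> ?E ?U} \<subseteq> success" by (auto simp: success_def)
      then show ?thesis unfolding prob[OF U] by (intro finite_measure_mono meas)
    qed
    have "measure M success \<le> 4 * exp (- (lam\<^sup>2 / 16))"
      if "0 \<le> lam" "lam < sqrt (harm d)" "real m \<le> real d - harm d - lam * sqrt (harm d)" for lam
    proof -
      have "fact d * order_prob TYPE('m) UNIV xs \<le> fact d * (4 * exp (- (lam\<^sup>2 / 16)))"
        using order_prob_le[OF xs(1,2), where 'm = 'm] order_count_tail_upper[OF d that]
        unfolding d_def m_def by linarith
      then show ?thesis using upper by simp
    qed
    moreover have "measure M success \<ge> 1 - 4 * exp (- (lam\<^sup>2 / 16))"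
      if "0 \<le> lam" "lam < sqrt (harm d)" "real m \<ge> real d - harm d + lam * sqrt (harm d)" for lam
    proof -
      have "fact d * (1 - 4 * exp (- (lam\<^sup>2 / 16))) \<le> fact d * order_prob TYPE('m) ?U xs"
        using order_prob_ge[OF xs(1,2) t, where 'm = 'm] order_count_tail_lower[OF d m that]
        unfolding d_def m_def by linarith
      then show ?thesis using lower by simp
    qed
    ultimately show ?thesis using meas harm by blast
  qed
qed

end
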